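(* Let $D_1, D_2\subset\mathbb{C}$ be bounded domains with $C^1$ boundary. Let $f=f_1\,d\bar z_1+f_2\,d\bar z_2$ be a $(0,1)$-form of class $C^1$ on the closure $\overline{D_1\times D_2}$ satisfying $\bar\partial f=0$. Then the function $$ \begin{aligned} T(f)(z_1,z_2) &=\frac{-1}{2 \pi i}\int_{D_2}\frac{f_2(z_1,\zeta_2)}{\zeta_2-z_2}\,d\bar \zeta_2\wedge d\zeta_2+\frac{-1}{2 \pi i}\int_{D_1}\frac{f_1(\zeta_1,z_2)}{\zeta_1-z_1}\,d\bar \zeta_1\wedge d\zeta_1\\ &\quad+\frac{-1}{(2 \pi i)^2}\int_{D_1 \times D_2}\frac{(\mathscr{D}f)(\zeta_1,\zeta_2)}{(\zeta_1-z_1)(\zeta_2-z_2)}\,d\bar \zeta_1\wedge d\zeta_1\wedge d\bar \zeta_2\wedge d\zeta_2 \end{aligned} $$ on $D_1\times D_2$, where $\mathscr{D} f =\frac{\partial f_1}{\partial \bar z_2}=\frac{\partial f_2}{\partial \bar z_1}$, solves $\bar\partial (Tf) =f$ on $D_1\times D_2$.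
   Context: For a $(0,1)$-form $f=f_1\,d\bar z_1+f_2\,d\bar z_2$ on a subset of $\mathbb{C}^2$, $\bar\partial f=0$ means $\frac{\partial f_1}{\partial \bar z_2}=\frac{\partial f_2}{\partial \bar z_1}$, and $\bar\partial u=f$ means $\frac{\partial u}{\partial\bar z_j}=f_j$ for $j=1,2$. In one complex variable $d\bar\zeta\wedge d\zeta = 2i\,dA(\zeta)$, with $dA$ Lebesgue measure on $\mathbb{C}$. *)

theory Defs
  imports "HOL-Analysis.Analysis"
begin

definition C1_on :: "'a::real_normed_vector set \<Rightarrow> ('a \<Rightarrow> 'b::real_normed_vector) \<Rightarrow> ('a \<Rightarrow> 'a \<Rightarrow>\<^sub>L 'b) \<Rightarrow> bool"
  where "C1_on U g g' \<longleftrightarrow>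
    (\<forall>x\<in>U. (g has_derivative blinfun_apply (g' x)) (at x)) \<and> continuous_on U g'"

text \<open>Class \<open>C\<^sup>1\<close> up to the boundary of an open set \<open>U\<close>: \<open>g\<close> is continuous on the closure,
  differentiable on \<open>U\<close>, and its derivative extends continuously to the closure. Restrictions of
  \<open>C\<^sup>1\<close> functions on a neighbourhood of the closure are included.\<close>

definition C1_on_closure :: "'a::real_normed_vector set \<Rightarrow> ('a \<Rightarrow> 'b::real_normed_vector) \<Rightarrow> bool"
  where "C1_on_closure U g \<longleftrightarrow>
    continuous_on (closure U) g \<and> (\<exists>g'. C1_on U g g' \<and> continuous_on (closure U) g')"

text \<open>Near each boundary point, \<open>D\<close> is the sublevel set of a \<open>C\<^sup>1\<close> local defining function
  with nowhere vanishing differential; in particular \<open>D\<close> lies locally on one side of its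
  boundary.\<close>

definition C1_boundary :: "complex set \<Rightarrow> bool"
  where "C1_boundary D \<longleftrightarrow>
    (\<forall>p\<in>frontier D. \<exists>U (r :: complex \<Rightarrow> real) r'. open U \<and> p \<in> U \<and>
       C1_on U r r' \<and> (\<forall>x\<in>U. r' x \<noteq> 0) \<and> D \<inter> U = {x \<in> U. r x < 0})"

definition bounded_C1_domain :: "complex set \<Rightarrow> bool"
  where "bounded_C1_domain D \<longleftrightarrow>
    open D \<and> connected D \<and> D \<noteq> {} \<and> bounded D \<and> C1_boundary D"

text \<open>The Wirtinger derivative \<open>(\<partial>g/\<partial>x + i \<partial>g/\<partial>y) / 2\<close> with respect to the conjugate variable.
  Its value is only meaningful where these partial derivatives exist.\<close>

definition wirtinger_bar :: "(complex \<Rightarrow> complex) \<Rightarrow> complex \<Rightarrow> complex"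
  where "wirtinger_bar g z =
    (vector_derivative (\<lambda>t::real. g (z + of_real t)) (at 0)
      + \<i> * vector_derivative (\<lambda>t::real. g (z + \<i> * of_real t)) (at 0)) / 2"

definition dbar1 :: "(complex \<times> complex \<Rightarrow> complex) \<Rightarrow> complex \<times> complex \<Rightarrow> complex"
  where "dbar1 u z = wirtinger_bar (\<lambda>w. u (w, snd z)) (fst z)"

definition dbar2 :: "(complex \<times> complex \<Rightarrow> complex) \<Rightarrow> complex \<times> complex \<Rightarrow> complex"
  where "dbar2 u z = wirtinger_bar (\<lambda>w. u (fst z, w)) (snd z)"

text \<open>A \<open>(0,1)\<close>-form on a subset of \<open>\<complex>\<^sup>2\<close> is given by its two coefficient functions \<open>f1\<close>, \<open>f2\<close>.\<close>

definition dbar_closed_on ::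
    "(complex \<times> complex) set \<Rightarrow> (complex \<times> complex \<Rightarrow> complex) \<Rightarrow> (complex \<times> complex \<Rightarrow> complex) \<Rightarrow> bool"
  where "dbar_closed_on \<Omega> f1 f2 \<longleftrightarrow> (\<forall>z\<in>\<Omega>. dbar2 f1 z = dbar1 f2 z)"

text \<open>Classical solutions: real differentiability of \<open>u\<close> is part of the definition, so the
  Wirtinger derivatives below are genuine ones.\<close>

definition solves_dbar_on ::
    "(complex \<times> complex) set \<Rightarrow> (complex \<times> complex \<Rightarrow> complex) \<Rightarrow>
     (complex \<times> complex \<Rightarrow> complex) \<Rightarrow> (complex \<times> complex \<Rightarrow> complex) \<Rightarrow> bool"
  where "solves_dbar_on \<Omega> u f1 f2 \<longleftrightarrow>
    (\<forall>z\<in>\<Omega>. u differentiable (at z) \<and> dbar1 u z = f1 z \<and> dbar2 u z = f2 z)"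

text \<open>Integration against \<open>d\<zeta>bar \<and> d\<zeta> = 2i dA\<close>, and against the product of the two such
  forms, which is \<open>(2i)\<^sup>2\<close> times Lebesgue measure on \<open>\<complex>\<^sup>2\<close>.\<close>

definition form_integral1 :: "complex set \<Rightarrow> (complex \<Rightarrow> complex) \<Rightarrow> complex"
  where "form_integral1 D g = 2 * \<i> * (LINT \<zeta>:D|lborel. g \<zeta>)"

definition form_integral2 :: "(complex \<times> complex) set \<Rightarrow> (complex \<times> complex \<Rightarrow> complex) \<Rightarrow> complex"
  where "form_integral2 \<Omega> g = (2 * \<i>)\<^sup>2 * (LINT \<zeta>:\<Omega>|lborel. g \<zeta>)"

text \<open>The third integrand uses \<open>dbar2 f1\<close>, which agrees with \<open>dbar1 f2\<close> for closed forms.\<close>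

definition T_op ::
    "complex set \<Rightarrow> complex set \<Rightarrow> (complex \<times> complex \<Rightarrow> complex) \<Rightarrow> (complex \<times> complex \<Rightarrow> complex)
     \<Rightarrow> complex \<times> complex \<Rightarrow> complex"
  where "T_op D1 D2 f1 f2 = (\<lambda>(z1, z2).
      (-1) / (2 * of_real pi * \<i>) * form_integral1 D2 (\<lambda>\<zeta>2. f2 (z1, \<zeta>2) / (\<zeta>2 - z2))
    + (-1) / (2 * of_real pi * \<i>) * form_integral1 D1 (\<lambda>\<zeta>1. f1 (\<zeta>1, z2) / (\<zeta>1 - z1))
    + (-1) / (2 * of_real pi * \<i>)\<^sup>2 * form_integral2 (D1 \<times> D2)
        (\<lambda>(\<zeta>1, \<zeta>2). dbar2 f1 (\<zeta>1, \<zeta>2) / ((\<zeta>1 - z1) * (\<zeta>2 - z2))))"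

end

theory Submission
  imports Defs
begin

text \<open>Write \<open>C\<^sub>j g (z\<^sub>j) = -1/\<pi> \<integral> g (\<zeta>\<^sub>j) / (\<zeta>\<^sub>j - z\<^sub>j)\<close> for the Cauchy transform in the \<open>j\<close>-th
  variable and extend \<open>f\<^sub>1\<close>, \<open>f\<^sub>2\<close> and \<open>\<D>f\<close> by zero, so that
  \<open>Tf = C\<^sub>2 f\<^sub>2 + C\<^sub>1 f\<^sub>1 - C\<^sub>1 C\<^sub>2 \<D>f\<close>. Since \<open>\<D>f\<close> is only continuous, the last summand cannot be
  differentiated on its own. Let \<open>\<theta>\<^sub>j\<close> be a \<open>C\<^sup>1\<close> cutoff in \<open>D\<^sub>j\<close>, equal to \<open>1\<close> near the point
  considered, with antiholomorphic derivative \<open>X\<^sub>j\<close>. The Cauchy--Pompeiu formula applied to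
  \<open>\<theta>\<^sub>1 f\<^sub>2\<close> and \<open>\<theta>\<^sub>2 f\<^sub>1\<close> reads \<open>f\<^sub>2 = C\<^sub>1 (\<theta>\<^sub>1 \<D>f + X\<^sub>1 f\<^sub>2)\<close> and \<open>f\<^sub>1 = C\<^sub>2 (\<theta>\<^sub>2 \<D>f + X\<^sub>2 f\<^sub>1)\<close>
  near the point, and it turns \<open>Tf\<close> into
  \<open>C\<^sub>1 (\<theta>\<^sub>1 f\<^sub>1) + C\<^sub>1 C\<^sub>2 (\<theta>\<^sub>2 X\<^sub>1 f\<^sub>2) + C\<^sub>1 C\<^sub>2 N\<close> with
  \<open>N = (1 - \<theta>\<^sub>2) X\<^sub>1 f\<^sub>2 + (1 - \<theta>\<^sub>1) X\<^sub>2 f\<^sub>1 - (1 - \<theta>\<^sub>1) (1 - \<theta>\<^sub>2) \<D>f\<close>. The kernels are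
  singular only against \<open>C\<^sup>1\<close> functions now, so after a translation all three terms can be
  differentiated under the integral sign. The third is holomorphic, the first has
  \<open>z\<^sub>1\<close>-bar derivative \<open>f\<^sub>1\<close> and \<open>z\<^sub>2\<close>-bar derivative \<open>f\<^sub>2 - C\<^sub>1 (X\<^sub>1 f\<^sub>2)\<close>, the second \<open>0\<close> and
  \<open>C\<^sub>1 (X\<^sub>1 f\<^sub>2)\<close>.\<close>

section \<open>Differentiation under the integral sign\<close>

text \<open>Steps of size \<open>1 / real (Suc n)\<close> turn a directional derivative into the
  limit of a sequence, the form required by measurability of limits and by dominated
  convergence.\<close>

lemma has_derivative_direction_LIMSEQ:
  fixes f :: "'a::real_normed_vector \<Rightarrow> 'b::real_normed_vector"
  assumes "(f has_derivative f') (at x)"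
  shows "(\<lambda>n. real (Suc n) *\<^sub>R (f (x + (1 / real (Suc n)) *\<^sub>R h) - f x)) \<longlonglongrightarrow> f' h"
proof -
  interpret f': bounded_linear f' using assms by (rule has_derivative_bounded_linear)
  have "((\<lambda>t. f (x + t *\<^sub>R h)) has_derivative (\<lambda>t. f' (t *\<^sub>R h))) (at (0::real))"
  proof (rule has_derivative_compose[where g = f, of "\<lambda>t. x + t *\<^sub>R h" "\<lambda>t. t *\<^sub>R h"])
    show "((\<lambda>t. x + t *\<^sub>R h) has_derivative (\<lambda>t. t *\<^sub>R h)) (at 0)"
      by (auto intro!: derivative_eq_intros)
  qed (use assms in simp)
  then have "((\<lambda>t. norm (f (x + t *\<^sub>R h) - f x - f' (t *\<^sub>R h)) / norm t) \<longlongrightarrow> 0) (at 0)"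
    by (simp add: has_derivative_iff_norm)
  moreover have "\<forall>\<^sub>F t in at 0. norm (f (x + t *\<^sub>R h) - f x - f' (t *\<^sub>R h)) / norm t
      = norm ((f (x + t *\<^sub>R h) - f x) /\<^sub>R t - f' h)"
    unfolding eventually_at_filter
  proof (intro always_eventually allI impI)
    fix t :: real assume t: "t \<noteq> 0"
    have "(f (x + t *\<^sub>R h) - f x) /\<^sub>R t - f' h = (f (x + t *\<^sub>R h) - f x - f' (t *\<^sub>R h)) /\<^sub>R t"
      using t by (simp add: f'.scaleR scaleR_diff_right)
    then show "norm (f (x + t *\<^sub>R h) - f x - f' (t *\<^sub>R h)) / norm t
        = norm ((f (x + t *\<^sub>R h) - f x) /\<^sub>R t - f' h)"
      by (simp add: divide_inverse mult.commute)
  qed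
  ultimately have "((\<lambda>t. norm ((f (x + t *\<^sub>R h) - f x) /\<^sub>R t - f' h)) \<longlongrightarrow> 0) (at 0)"
    by (rule Lim_transform_eventually)
  then have lim: "((\<lambda>t. (f (x + t *\<^sub>R h) - f x) /\<^sub>R t) \<longlongrightarrow> f' h) (at 0)"
    using Lim_null tendsto_norm_zero_iff by blast
  have "filterlim (\<lambda>n. 1 / real (Suc n)) (at 0) sequentially"
    unfolding filterlim_at using lim_inverse_n' LIMSEQ_Suc[OF lim_inverse_n'] by auto
  from filterlim_compose[OF lim this] show ?thesis
    by (simp add: divide_inverse)
qed

text \<open>Domination is imposed on difference quotients centred at \<open>a\<close>, so that only
  derivatives at this one point enter. The Taylor remainder divided by \<open>norm (p - a)\<close>
  tends to 0 pointwise and stays below \<open>2 * b w\<close>; dominated convergence along every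
  sequence tending to \<open>a\<close> then gives a total derivative.\<close>

lemma leibniz_integral:
  fixes F :: "'p::real_normed_vector \<Rightarrow> 'w \<Rightarrow> 'c::{banach, second_countable_topology}"
  assumes e: "e > 0"
    and int: "\<And>p. p \<in> ball a e \<Longrightarrow> integrable M (F p)"
    and der: "\<And>w. w \<in> space M \<Longrightarrow> ((\<lambda>p. F p w) has_derivative F' w) (at a)"
    and lip: "\<And>p w. p \<in> ball a e \<Longrightarrow> w \<in> space M \<Longrightarrow> norm (F p w - F a w) \<le> b w * norm (p - a)"
    and b: "integrable M b"
  shows "((\<lambda>p. \<integral>w. F p w \<partial>M) has_derivative (\<lambda>h. \<integral>w. F' w h \<partial>M)) (at a)"
    and "\<And>h. integrable M (\<lambda>w. F' w h)"
proof -
  let ?q = "\<lambda>h n w. real (Suc n) *\<^sub>R (F (a + (1 / real (Suc n)) *\<^sub>R h) w - F a w)"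
  have q_lim: "(\<lambda>n. ?q h n w) \<longlonglongrightarrow> F' w h" if "w \<in> space M" for h w
    using has_derivative_direction_LIMSEQ[OF der[OF that]] .
  have ev: "\<exists>N. \<forall>n\<ge>N. a + (1 / real (Suc n)) *\<^sub>R h \<in> ball a e" for h
  proof -
    have "(\<lambda>n. norm ((1 / real (Suc n)) *\<^sub>R h)) \<longlonglongrightarrow> norm (0 *\<^sub>R h)"
      by (intro tendsto_intros LIMSEQ_Suc[OF lim_inverse_n'])
    then have "\<forall>\<^sub>F n in sequentially. norm ((1 / real (Suc n)) *\<^sub>R h) < e"
      using e by (intro order_tendstoD) auto
    then show ?thesis by (simp add: eventually_sequentially dist_norm)
  qed
  \<comment> \<open>The derivative inherits the Lipschitz weight \<open>b w\<close> as a limit of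
    the quotients, which obey it as soon as their base points enter the ball.\<close>
  have bound: "norm (F' w h) \<le> b w * norm h" if w: "w \<in> space M" for h w
  proof (rule LIMSEQ_le_const2[OF tendsto_norm[OF q_lim[OF w]]])
    obtain N where N: "\<And>n. n \<ge> N \<Longrightarrow> a + (1 / real (Suc n)) *\<^sub>R h \<in> ball a e" using ev by blast
    have "norm (?q h n w) \<le> b w * norm h" if "n \<ge> N" for n
    proof -
      have "norm (?q h n w) = real (Suc n) * norm (F (a + (1 / real (Suc n)) *\<^sub>R h) w - F a w)" by simp
      also have "\<dots> \<le> real (Suc n) * (b w * norm ((1 / real (Suc n)) *\<^sub>R h))"
        using lip[OF N[OF that] w] by (intro mult_left_mono) auto
      also have "\<dots> = b w * norm h" by simp
      finally show ?thesis .
    qed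
    then show "\<exists>N. \<forall>n\<ge>N. norm (?q h n w) \<le> b w * norm h" by blast
  qed
  have a: "a \<in> ball a e" using e by simp
  have meas: "(\<lambda>w. F' w h) \<in> borel_measurable M" for h
  proof -
    obtain N where N: "\<And>n. n \<ge> N \<Longrightarrow> a + (1 / real (Suc n)) *\<^sub>R h \<in> ball a e" using ev by blast
    show ?thesis
    proof (rule borel_measurable_LIMSEQ_metric)
      \<comment> \<open>Integrability of \<open>F p\<close> is known only for \<open>p\<close> in
        the ball, hence the first \<open>N\<close> quotients are dropped.\<close>
      show "(\<lambda>w. ?q h (n + N) w) \<in> borel_measurable M" for n
        using borel_measurable_integrable[OF int[OF N, of "n+N"]] borel_measurable_integrable[OF int[OF a]]
        by simp
      show "(\<lambda>n. ?q h (n + N) w) \<longlonglongrightarrow> F' w h" if "w \<in> space M" for w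
        using LIMSEQ_ignore_initial_segment[OF q_lim[OF that]] .
    qed
  qed
  show int': "integrable M (\<lambda>w. F' w h)" for h
  proof (rule Bochner_Integration.integrable_bound[OF _ meas])
    show "integrable M (\<lambda>w. b w * norm h)" using b by simp
    show "AE w in M. norm (F' w h) \<le> norm (b w * norm h)"
      using bound by (intro AE_I2) (smt (verit) real_norm_def)
  qed
  have lin: "bounded_linear (F' w)" if "w \<in> space M" for w
    using der[OF that] by (rule has_derivative_bounded_linear)
  have blin: "bounded_linear (\<lambda>h. \<integral>w. F' w h \<partial>M)"
  proof (rule bounded_linear_intro[where K = "\<integral>w. b w \<partial>M"])
    show "(\<integral>w. F' w (x + y) \<partial>M) = (\<integral>w. F' w x \<partial>M) + (\<integral>w. F' w y \<partial>M)" for x y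
      by (subst Bochner_Integration.integral_add[symmetric])
         (auto intro!: int' Bochner_Integration.integral_cong simp: linear_add[OF bounded_linear.linear[OF lin]])
    show "(\<integral>w. F' w (r *\<^sub>R x) \<partial>M) = r *\<^sub>R (\<integral>w. F' w x \<partial>M)" for r x
    proof -
      have "(\<integral>w. F' w (r *\<^sub>R x) \<partial>M) = (\<integral>w. r *\<^sub>R F' w x \<partial>M)"
        by (intro Bochner_Integration.integral_cong) (auto simp: linear_cmul[OF bounded_linear.linear[OF lin]])
      then show ?thesis by simp
    qed
    show "norm (\<integral>w. F' w x \<partial>M) \<le> norm x * (\<integral>w. b w \<partial>M)" for x
    proof -
      have "norm (\<integral>w. F' w x \<partial>M) \<le> (\<integral>w. b w * norm x \<partial>M)"
        by (rule order_trans[OF Bochner_Integration.integral_norm_bound integral_mono]) (use int' b bound in auto)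
      then show ?thesis by (simp add: mult.commute)
    qed
  qed
  have "((\<lambda>p. \<integral>w. F p w \<partial>M) has_derivative (\<lambda>h. \<integral>w. F' w h \<partial>M)) (at a within ball a e)"
    unfolding has_derivative_iff_norm
  proof (intro conjI blin)
    show "((\<lambda>y. norm ((\<integral>w. F y w \<partial>M) - (\<integral>w. F a w \<partial>M) - (\<integral>w. F' w (y - a) \<partial>M)) / norm (y - a)) \<longlongrightarrow> 0)
      (at a within ball a e)"
      unfolding tendsto_at_iff_sequentially
    proof (intro allI impI)
      fix X :: "nat \<Rightarrow> 'p"
      assume X: "\<forall>i. X i \<in> ball a e - {a}" and Xl: "X \<longlonglongrightarrow> a"
      let ?s = "\<lambda>i w. (F (X i) w - F a w - F' w (X i - a)) /\<^sub>R norm (X i - a)"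
      have XI: "integrable M (F (X i))" for i using int X by auto
      have "(\<lambda>i. \<integral>w. ?s i w \<partial>M) \<longlonglongrightarrow> (\<integral>w. 0 \<partial>M)"
      \<comment> \<open>One \<open>b w\<close> pays for the increment of \<open>F\<close>, the other
        for its linear part.\<close>
      proof (rule integral_dominated_convergence[where w = "\<lambda>w. 2 * b w"])
        show "integrable M (\<lambda>w. 2 * b w)" using b by simp
        show "?s i \<in> borel_measurable M" for i
          using borel_measurable_integrable[OF XI] borel_measurable_integrable[OF int[OF a]] meas by simp
        show "AE w in M. (\<lambda>i. ?s i w) \<longlonglongrightarrow> 0"
        proof (rule AE_I2)
          fix w assume w: "w \<in> space M"
          have "((\<lambda>y. (F y w - F a w - F' w (y - a)) /\<^sub>R norm (y - a)) \<longlongrightarrow> 0) (at a)"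
            using der[OF w] unfolding has_derivative_at_within by simp
          then show "(\<lambda>i. ?s i w) \<longlonglongrightarrow> 0"
            unfolding tendsto_at_iff_sequentially using X Xl by (auto simp: o_def)
        qed
        show "AE w in M. norm (?s i w) \<le> 2 * b w" for i
        proof (rule AE_I2)
          fix w assume w: "w \<in> space M"
          have np: "norm (X i - a) > 0" using X by auto
          have "norm (F (X i) w - F a w - F' w (X i - a)) \<le> b w * norm (X i - a) + b w * norm (X i - a)"
            using lip[of "X i" w] X w bound[OF w, of "X i - a"]
            by (intro order_trans[OF norm_triangle_ineq4]) (auto intro!: add_mono)
          moreover have "norm (?s i w) = norm (F (X i) w - F a w - F' w (X i - a)) / norm (X i - a)"
            by (simp add: divide_inverse mult.commute)
          ultimately show "norm (?s i w) \<le> 2 * b w"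
            using np by (simp add: divide_le_eq)
        qed
      qed simp
      then have "(\<lambda>i. norm (\<integral>w. ?s i w \<partial>M)) \<longlonglongrightarrow> 0"
        using tendsto_norm_zero by force
      moreover have "norm (\<integral>w. ?s i w \<partial>M)
          = norm ((\<integral>w. F (X i) w \<partial>M) - (\<integral>w. F a w \<partial>M) - (\<integral>w. F' w (X i - a) \<partial>M)) / norm (X i - a)" for i
        using XI int[OF a] int'
        by (simp add: Bochner_Integration.integral_diff divide_inverse mult.commute)
      ultimately show "((\<lambda>y. norm ((\<integral>w. F y w \<partial>M) - (\<integral>w. F a w \<partial>M) - (\<integral>w. F' w (y - a) \<partial>M)) / norm (y - a)) \<circ> X)
          \<longlonglongrightarrow> 0"
        by (simp add: o_def)
    qed
  qed
  then show "((\<lambda>p. \<integral>w. F p w \<partial>M) has_derivative (\<lambda>h. \<integral>w. F' w h \<partial>M)) (at a)"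
    using at_within_open[OF a open_ball] by simp
qed

text \<open>Although \<open>g'\<close> carries no continuity, it is a pointwise limit of difference
  quotients of the continuous function \<open>g\<close>, hence Borel.\<close>

lemma borel_measurable_has_derivative:
  fixes g :: "'a::euclidean_space \<Rightarrow> 'b::euclidean_space"
  assumes "\<And>z. (g has_derivative g' z) (at z)"
  shows "(\<lambda>z. g' z h) \<in> borel_measurable borel"
proof (rule borel_measurable_LIMSEQ_metric)
  have "continuous_on UNIV g"
    by (metis assms continuous_at_imp_continuous_on has_derivative_continuous)
  then have [measurable]: "g \<in> borel_measurable borel" by (rule borel_measurable_continuous_onI)
  show "(\<lambda>z. real (Suc n) *\<^sub>R (g (z + (1 / real (Suc n)) *\<^sub>R h) - g z)) \<in> borel_measurable borel" for n
    by measurable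
  show "(\<lambda>n. real (Suc n) *\<^sub>R (g (z + (1 / real (Suc n)) *\<^sub>R h) - g z)) \<longlonglongrightarrow> g' z h" for z
    by (rule has_derivative_direction_LIMSEQ[OF assms])
qed

section \<open>Translation, scaling and bounded support for Lebesgue integrals\<close>

lemma integral_lborel_translate:
  fixes f :: "'a::euclidean_space \<Rightarrow> 'b::{banach, second_countable_topology}"
  assumes [measurable]: "f \<in> borel_measurable borel"
  shows "(\<integral>x. f (c + x) \<partial>lborel) = (\<integral>x. f x \<partial>lborel)"
    and "integrable lborel (\<lambda>x. f (c + x)) \<longleftrightarrow> integrable lborel f"
proof -
  show "(\<integral>x. f (c + x) \<partial>lborel) = (\<integral>x. f x \<partial>lborel)"
    using integral_distr[of "(+) c" lborel borel f] by (simp add: lborel_distr_plus)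
  show "integrable lborel (\<lambda>x. f (c + x)) \<longleftrightarrow> integrable lborel f"
    using integrable_distr_eq[of "(+) c" lborel borel f] by (simp add: lborel_distr_plus)
qed

lemma integral_lborel_scale:
  fixes f :: "'a::euclidean_space \<Rightarrow> 'b::{banach, second_countable_topology}"
  assumes [measurable]: "f \<in> borel_measurable borel" and c: "c > 0"
  shows "(\<integral>x. f x \<partial>lborel) = c ^ DIM('a) *\<^sub>R (\<integral>x. f (c *\<^sub>R x) \<partial>lborel)"
  using c by (subst lborel_affine[of c 0]) (simp_all add: integral_density integral_distr)

lemma integrableI_bounded_support:
  fixes f :: "'a::euclidean_space \<Rightarrow> 'b::{banach, second_countable_topology}"
  assumes [measurable]: "f \<in> borel_measurable borel"
    and "\<And>x. norm (f x) \<le> B" and "\<And>x. norm x > R \<Longrightarrow> f x = 0"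
  shows "integrable lborel f"
proof (rule integrableI_bounded_set[where A = "cball 0 R" and B = B])
  show "emeasure lborel (cball (0::'a) R) < \<infinity>"
    using emeasure_lborel_cball_finite by blast
qed (use assms in \<open>auto simp: not_le[symmetric]\<close>)

text \<open>The integral of \<open>\<Psi> (p + w)\<close> over \<open>w\<close> does not depend on \<open>p\<close>; differentiating in \<open>p\<close> replaces
  Stokes' theorem.\<close>

lemma integral_has_derivative_compact_support:
  fixes \<Psi> :: "'a::euclidean_space \<Rightarrow> 'b::euclidean_space"
  assumes der: "\<And>z. (\<Psi> has_derivative \<Psi>' z) (at z)"
    and lip: "\<And>z w. norm (\<Psi> z - \<Psi> w) \<le> L * norm (z - w)"
    and supp: "\<And>z. norm z > R \<Longrightarrow> \<Psi> z = 0"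
  shows "(\<integral>w. \<Psi>' w h \<partial>lborel) = 0" "integrable lborel (\<lambda>w. \<Psi>' w h)"
proof -
  have "continuous_on UNIV \<Psi>"
    by (metis der continuous_at_imp_continuous_on has_derivative_continuous)
  then have [measurable]: "\<Psi> \<in> borel_measurable borel" by (rule borel_measurable_continuous_onI)
  have "compact (\<Psi> ` cball 0 R)"
    using \<open>continuous_on UNIV \<Psi>\<close> by (intro compact_continuous_image) (auto elim: continuous_on_subset)
  then obtain B where B: "norm (\<Psi> z) \<le> B" if "norm z \<le> R" for z
    by (metis compact_imp_bounded bounded_iff image_eqI mem_cball_0)
  have "norm (\<Psi> z) \<le> max B 0" for z
    using B[of z] supp[of z] by (cases "norm z \<le> R") auto
  then have int: "integrable lborel \<Psi>"
    using supp by (intro integrableI_bounded_support) auto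
  have F: "((\<lambda>p. \<integral>w. \<Psi> (p + w) \<partial>lborel) has_derivative (\<lambda>h. \<integral>w. \<Psi>' w h \<partial>lborel)) (at 0)"
    and I: "integrable lborel (\<lambda>w. \<Psi>' w h)" for h
  proof -
    have d: "((\<lambda>p. \<Psi> (p + w)) has_derivative \<Psi>' w) (at 0)" for w
      by (rule has_derivative_compose[of "\<lambda>p. p + w" "\<lambda>h. h" _ _ \<Psi>, simplified])
         (use der in \<open>auto intro!: derivative_eq_intros\<close>)
    \<comment> \<open>Shifts by \<open>p\<close> in the unit ball enlarge the support to radius
      \<open>R + 1\<close> at most, which makes the Lipschitz weight integrable.\<close>
    have l: "norm (\<Psi> (p + w) - \<Psi> (0 + w)) \<le> (\<bar>L\<bar> * indicator (cball 0 (R + 1)) w) * norm (p - 0)"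
      if "p \<in> ball 0 1" for p w
    proof (cases "norm w \<le> R + 1")
      case True
      have "norm (\<Psi> (p + w) - \<Psi> (0 + w)) \<le> L * norm p" using lip[of "p + w" "w"] by simp
      also have "\<dots> \<le> \<bar>L\<bar> * norm p" by (intro mult_right_mono) auto
      finally show ?thesis using True by simp
    next
      case False
      have "norm (p + w) > R" using that False norm_diff_ineq[of w p] by (simp add: add.commute)
      then show ?thesis using False supp by simp
    qed
    have b: "integrable lborel (\<lambda>w::'a. \<bar>L\<bar> * indicator (cball 0 (R + 1)) w)"
      by (intro integrableI_bounded_support[where B = "\<bar>L\<bar>" and R = "R+1"]) (auto simp: indicator_def)
    note L = leibniz_integral[where a = "0::'a" and e = 1 and M = lborel and F = "\<lambda>p w. \<Psi> (p + w)", OF _ _ d l b]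
    show "((\<lambda>p. \<integral>w. \<Psi> (p + w) \<partial>lborel) has_derivative (\<lambda>h. \<integral>w. \<Psi>' w h \<partial>lborel)) (at 0)"
      by (rule L(1)) (auto simp: integral_lborel_translate int)
    show "integrable lborel (\<lambda>w. \<Psi>' w h)"
      by (rule L(2)) (auto simp: integral_lborel_translate int)
  qed
  show "integrable lborel (\<lambda>w. \<Psi>' w h)" by (rule I)
  have "(\<lambda>h. \<integral>w. \<Psi>' w h \<partial>lborel) = (\<lambda>h. 0)"
    by (rule has_derivative_unique[OF F]) (simp add: integral_lborel_translate)
  then show "(\<integral>w. \<Psi>' w h \<partial>lborel) = 0" by meson
qed

section \<open>Radial integrals in the plane\<close>

lemma has_derivative_locally_constant:
  assumes "(f has_derivative f') (at z)" "open S" "z \<in> S" "\<And>y. y \<in> S \<Longrightarrow> f y = c"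
  shows "f' h = 0"
proof -
  have "(f has_derivative (\<lambda>h. 0)) (at z)"
    by (rule has_derivative_transform_within_open[OF has_derivative_const[of c]]) (use assms in auto)
  from has_derivative_unique[OF assms(1) this] show ?thesis by simp
qed

lemma bounded_derivative_imp_lipschitz:
  fixes f :: "'a::{real_normed_vector, perfect_space} \<Rightarrow> 'b::real_normed_vector"
  assumes "convex S"
    and "\<And>x. x \<in> S \<Longrightarrow> (f has_derivative f' x) (at x)"
    and "\<And>x h. x \<in> S \<Longrightarrow> norm (f' x h) \<le> L * norm h"
    and "x \<in> S" "y \<in> S"
  shows "norm (f x - f y) \<le> L * norm (x - y)"
proof (rule differentiable_bound[where f' = f', OF assms(1)])
  show "onorm (f' x) \<le> L" if "x \<in> S" for x
    by (rule onorm_le) (rule assms(3)[OF that])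
qed (use assms in \<open>auto intro: has_derivative_at_withinI\<close>)

text \<open>This does the work of polar coordinates. A radial function written as a tail integral of
  \<open>f\<close> is a superposition of indicators of discs; by Tonelli each disc of radius
  \<open>t\<close> contributes its area \<open>pi * t\<^sup>2\<close>, and discs of negative radius
  are empty.\<close>

lemma nn_integral_layer_cake:
  fixes f :: "real \<Rightarrow> real"
  assumes [measurable]: "f \<in> borel_measurable borel"
  shows "(\<integral>\<^sup>+(w::complex). \<integral>\<^sup>+t. ennreal (f t) * indicator {norm w..} t \<partial>lborel \<partial>lborel)
    = (\<integral>\<^sup>+t. ennreal (pi * t\<^sup>2 * f t) * indicator {0..} t \<partial>lborel)"
proof -
  have [measurable]: "Measurable.pred (borel \<Otimes>\<^sub>M borel) (\<lambda>(w::complex, t). norm w \<le> t)" by measurable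
  have "(\<integral>\<^sup>+(w::complex). \<integral>\<^sup>+t. ennreal (f t) * indicator {norm w..} t \<partial>lborel \<partial>lborel)
      = (\<integral>\<^sup>+(w::complex). \<integral>\<^sup>+t. (if norm w \<le> t then ennreal (f t) else 0) \<partial>lborel \<partial>lborel)"
    by (intro nn_integral_cong) (auto simp: indicator_def)
  also have "\<dots> = (\<integral>\<^sup>+t. \<integral>\<^sup>+(w::complex). (if norm w \<le> t then ennreal (f t) else 0) \<partial>lborel \<partial>lborel)"
    by (rule lborel_pair.Fubini') (simp add: lborel_prod[symmetric] split_beta')
  also have "\<dots> = (\<integral>\<^sup>+t. ennreal (pi * t\<^sup>2 * f t) * indicator {0..} t \<partial>lborel)"
  proof (intro nn_integral_cong)
    fix t :: real
    have "(\<integral>\<^sup>+(w::complex). (if norm w \<le> t then ennreal (f t) else 0) \<partial>lborel)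
        = (\<integral>\<^sup>+(w::complex). ennreal (f t) * indicator (cball 0 t) w \<partial>lborel)"
      by (intro nn_integral_cong) (auto simp: indicator_def)
    also have "\<dots> = ennreal (f t) * emeasure lborel (cball (0::complex) t)"
      by (simp add: nn_integral_cmult_indicator)
    also have "\<dots> = ennreal (pi * t\<^sup>2 * f t) * indicator {0..} t"
      by (cases "t \<ge> 0") (auto simp: emeasure_cball unit_ball_vol_2 ennreal_mult'[symmetric] ennreal_mult''[symmetric] ac_simps)
    finally show "(\<integral>\<^sup>+(w::complex). (if norm w \<le> t then ennreal (f t) else 0) \<partial>lborel)
        = ennreal (pi * t\<^sup>2 * f t) * indicator {0..} t" .
  qed
  finally show ?thesis .
qed

text \<open>The value \<open>pi\<close> is the mass of the approximate identity in the
  Cauchy-Pompeiu formula.\<close>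

lemma integral_inverse_square_one_plus_norm_square:
  shows "integrable lborel (\<lambda>w::complex. 1 / (1 + (norm w)\<^sup>2)\<^sup>2)"
    and "(\<integral>(w::complex). 1 / (1 + (norm w)\<^sup>2)\<^sup>2 \<partial>lborel) = pi"
proof -
  \<comment> \<open>\<open>?f\<close> is minus the derivative of
    \<open>1 / (1 + t\<^sup>2)\<^sup>2\<close>, so its tail integral from \<open>norm w\<close> is
    the integrand. Weighted with the disc area it has the antiderivative
    \<open>pi * t^4 / (1 + t\<^sup>2)\<^sup>2\<close>.\<close>
  let ?f = "\<lambda>t::real. 4 * t / (1 + t\<^sup>2) ^ 3"
  have pos: "1 + t\<^sup>2 \<noteq> 0" "1 + t\<^sup>2 > 0" for t :: real
    using zero_le_power2[of t] by linarith+
  have 1: "(\<integral>\<^sup>+t. ennreal (?f t) * indicator {norm w..} t \<partial>lborel) = ennreal (1 / (1 + (norm w)\<^sup>2)\<^sup>2)" for w :: complex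
  proof -
    have "(\<integral>\<^sup>+t. ennreal (?f t) * indicator {norm w..} t \<partial>lborel) = ennreal (0 - (- 1 / (1 + (norm w)\<^sup>2)\<^sup>2))"
    proof (rule nn_integral_FTC_atLeast)
      show "((\<lambda>t. - 1 / (1 + t\<^sup>2)\<^sup>2) has_real_derivative ?f t) (at t)" for t :: real
      proof -
        have "((\<lambda>t. - 1 / (1 + t\<^sup>2)\<^sup>2) has_real_derivative
            2 * (1 + t\<^sup>2) * (2 * t) / ((1 + t\<^sup>2)\<^sup>2 * (1 + t\<^sup>2)\<^sup>2)) (at t)"
          using pos(1)[of t] by (auto intro!: derivative_eq_intros simp: power2_eq_square)
            (simp add: divide_simps; simp add: algebra_simps)
        moreover have "2 * (1 + t\<^sup>2) * (2 * t) / ((1 + t\<^sup>2)\<^sup>2 * (1 + t\<^sup>2)\<^sup>2) = ?f t"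
        proof -
          define N where "N = 1 + t\<^sup>2"
          have "N \<noteq> 0" using pos(1)[of t] by (simp add: N_def)
          then show ?thesis unfolding N_def[symmetric]
            by (simp add: divide_simps) (simp add: power2_eq_square power3_eq_cube power4_eq_xxxx)
        qed
        ultimately show ?thesis by simp
      qed
      show "((\<lambda>t::real. - 1 / (1 + t\<^sup>2)\<^sup>2) \<longlongrightarrow> 0) at_top" by real_asymp
      show "0 \<le> ?f t" if "norm w \<le> t" for t
      proof -
        have "0 \<le> t" using that norm_ge_zero[of w] by linarith
        then show ?thesis using pos(2)[of t] by simp
      qed
    qed measurable
    then show ?thesis by simp
  qed
  have 2: "(\<integral>\<^sup>+t. ennreal (pi * t\<^sup>2 * ?f t) * indicator {0..} t \<partial>lborel) = ennreal (pi - pi * 0^4 / (1 + 0\<^sup>2)\<^sup>2)"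
  proof (rule nn_integral_FTC_atLeast)
    show "((\<lambda>t. pi * t^4 / (1 + t\<^sup>2)\<^sup>2) has_real_derivative pi * t\<^sup>2 * ?f t) (at t)" for t :: real
    proof -
      have "((\<lambda>t. pi * t^4 / (1 + t\<^sup>2)\<^sup>2) has_real_derivative
          (pi * (4 * t^3) * (1 + t\<^sup>2)\<^sup>2 - pi * t^4 * (2 * (1 + t\<^sup>2) * (2 * t))) / ((1 + t\<^sup>2)\<^sup>2 * (1 + t\<^sup>2)\<^sup>2)) (at t)"
        using pos(1)[of t] by (auto intro!: derivative_eq_intros simp: power2_eq_square)
      moreover have "(pi * (4 * t^3) * (1 + t\<^sup>2)\<^sup>2 - pi * t^4 * (2 * (1 + t\<^sup>2) * (2 * t))) / ((1 + t\<^sup>2)\<^sup>2 * (1 + t\<^sup>2)\<^sup>2)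
          = pi * t\<^sup>2 * ?f t"
      proof -
        define N where "N = 1 + t\<^sup>2"
        have N: "N \<noteq> 0" using pos(1)[of t] by (simp add: N_def)
        have "pi * (4 * t^3) * N\<^sup>2 - pi * t^4 * (2 * N * (2 * t)) = 4 * pi * t^3 * N * (N - t\<^sup>2)"
          by (simp add: power2_eq_square power3_eq_cube power4_eq_xxxx algebra_simps)
        also have "N - t\<^sup>2 = 1" by (simp add: N_def)
        finally show ?thesis using N unfolding N_def[symmetric]
          by (simp add: divide_simps) (simp add: power2_eq_square power3_eq_cube power4_eq_xxxx)
      qed
      ultimately show ?thesis by simp
    qed
    show "((\<lambda>t::real. pi * t^4 / (1 + t\<^sup>2)\<^sup>2) \<longlongrightarrow> pi) at_top" by real_asymp
    show "0 \<le> pi * t\<^sup>2 * ?f t" if "0 \<le> t" for t :: real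
      using that pos(2)[of t] by auto
  qed measurable
  have nn: "(\<integral>\<^sup>+(w::complex). ennreal (1 / (1 + (norm w)\<^sup>2)\<^sup>2) \<partial>lborel) = ennreal pi"
    using nn_integral_layer_cake[of ?f] unfolding 1 2 by simp
  show "integrable lborel (\<lambda>w::complex. 1 / (1 + (norm w)\<^sup>2)\<^sup>2)"
    by (rule integrableI_nonneg) (use nn in auto)
  show "(\<integral>(w::complex). 1 / (1 + (norm w)\<^sup>2)\<^sup>2 \<partial>lborel) = pi"
    by (subst integral_eq_nn_integral) (use nn in auto)
qed

lemma integrable_inverse_norm_complex:
  "integrable lborel (\<lambda>w::complex. indicator (cball z R) w / norm (w - z))"
proof -
  \<comment> \<open>\<open>?G\<close> behaves like 1/t at the origin and like the inverse cube of t
    at infinity, so it is integrable over the whole plane as a radial function; on the disc of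
    radius \<open>R\<close> it controls 1/t up to the factor \<open>(1 + R)\<^sup>2\<close>.
    \<open>?f\<close> is minus its derivative.\<close>
  let ?f = "\<lambda>t::real. (1 + 3 * t) / (t\<^sup>2 * (1 + t) ^ 3)"
  let ?G = "\<lambda>t::real. 1 / (t * (1 + t)\<^sup>2)"
  have meas: "(\<lambda>w::complex. indicator (cball 0 R) w / norm w) \<in> borel_measurable borel"
    by (intro borel_measurable_divide borel_measurable_indicator borel_measurable_norm) auto
  \<comment> \<open>At \<open>w = 0\<close> the left side is 0 because \<open>1 / 0 = 0\<close>,
    while the tail integral is infinite; hence an inequality.\<close>
  have 1: "ennreal (?G (norm w)) \<le> (\<integral>\<^sup>+t. ennreal (?f t) * indicator {norm w..} t \<partial>lborel)" for w :: complex
  proof (cases "w = 0")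
    case False
    then have w: "norm w > 0" by simp
    have "(\<integral>\<^sup>+t. ennreal (?f t) * indicator {norm w..} t \<partial>lborel) = ennreal (0 - (- ?G (norm w)))"
    proof (rule nn_integral_FTC_atLeast)
      show "((\<lambda>t. - ?G t) has_real_derivative ?f t) (at t)" if "norm w \<le> t" for t :: real
      proof -
        have t: "t > 0" using that w by linarith
        have "((\<lambda>t. - ?G t) has_real_derivative (1 * (1 + t)\<^sup>2 + t * (2 * (1 + t))) / (t * (1 + t)\<^sup>2)\<^sup>2) (at t)"
          using t by (auto intro!: derivative_eq_intros simp: power2_eq_square diff_divide_distrib add_divide_distrib)
        moreover have "(1 * (1 + t)\<^sup>2 + t * (2 * (1 + t))) / (t * (1 + t)\<^sup>2)\<^sup>2 = ?f t"
        proof -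
          have "1 * (1 + t)\<^sup>2 + t * (2 * (1 + t)) = (1 + 3 * t) * (1 + t)"
            by (simp add: power2_eq_square algebra_simps)
          then show ?thesis using t
            by (simp add: divide_simps) (simp add: power2_eq_square power3_eq_cube power4_eq_xxxx)
        qed
        ultimately show ?thesis by simp
      qed
      show "((\<lambda>t. - ?G t) \<longlongrightarrow> 0) at_top" by real_asymp
      show "0 \<le> ?f t" if "norm w \<le> t" for t
      proof -
        have "0 \<le> t" using that norm_ge_zero[of w] by linarith
        then show ?thesis by simp
      qed
    qed measurable
    then show ?thesis by simp
  qed simp
  have 2: "(\<integral>\<^sup>+t. ennreal (pi * t\<^sup>2 * ?f t) * indicator {0..} t \<partial>lborel) < \<infinity>"
  proof -
    have "(\<integral>\<^sup>+t. ennreal (pi * t\<^sup>2 * ?f t) * indicator {0..} t \<partial>lborel)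
        \<le> (\<integral>\<^sup>+t. ennreal (pi * (1 + 3 * t) / (1 + t) ^ 3) * indicator {0..} t \<partial>lborel)"
      by (intro nn_integral_mono) (auto simp: indicator_def intro!: ennreal_leI divide_nonneg_nonneg)
    \<comment> \<open>The antiderivative comes from partial fractions with
      \<open>1 + 3 * t = 3 * (1 + t) - 2\<close>.\<close>
    also have "\<dots> = ennreal (0 - pi * (- 3 / (1 + 0) + 1 / (1 + 0)\<^sup>2))"
    proof (rule nn_integral_FTC_atLeast)
      show "((\<lambda>t. pi * (- 3 / (1 + t) + 1 / (1 + t)\<^sup>2)) has_real_derivative pi * (1 + 3 * t) / (1 + t) ^ 3) (at t)"
        if "0 \<le> t" for t :: real
      proof -
        have "((\<lambda>t. pi * (- 3 / (1 + t) + 1 / (1 + t)\<^sup>2)) has_real_derivative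
            pi * (3 / (1 + t)\<^sup>2 - 2 * (1 + t) / ((1 + t)\<^sup>2)\<^sup>2)) (at t)"
        proof -
          have "((\<lambda>t. 1 / (1 + t)\<^sup>2) has_real_derivative - (2 * (1 + t) / ((1 + t)\<^sup>2)\<^sup>2)) (at t)"
            "((\<lambda>t. - 3 / (1 + t)) has_real_derivative 3 / (1 + t)\<^sup>2) (at t)"
            using that by (auto intro!: derivative_eq_intros simp: power2_eq_square)
               (simp only: minus_divide_left, simp)
          from DERIV_cmult[OF DERIV_add[OF this(2,1)], of pi] show ?thesis by simp
        qed
        moreover have "pi * (3 / (1 + t)\<^sup>2 - 2 * (1 + t) / ((1 + t)\<^sup>2)\<^sup>2) = pi * (1 + 3 * t) / (1 + t) ^ 3"
        proof -
          define s where "s = 1 + t"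
          have s: "s \<noteq> 0" "t = s - 1" using that by (simp_all add: s_def)
          then show ?thesis unfolding s_def[symmetric] unfolding s(2)
            by (simp add: field_simps power2_eq_square power3_eq_cube)
        qed
        ultimately show ?thesis by simp
      qed
      show "((\<lambda>t::real. pi * (- 3 / (1 + t) + 1 / (1 + t)\<^sup>2)) \<longlongrightarrow> 0) at_top" by real_asymp
    qed auto
    finally show ?thesis by (rule le_less_trans) simp
  qed
  have "(\<integral>\<^sup>+(w::complex). ennreal (?G (norm w)) \<partial>lborel) < \<infinity>"
  proof (rule le_less_trans)
    show "(\<integral>\<^sup>+(w::complex). ennreal (?G (norm w)) \<partial>lborel)
        \<le> (\<integral>\<^sup>+t. ennreal (pi * t\<^sup>2 * ?f t) * indicator {0..} t \<partial>lborel)"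
      by (subst nn_integral_layer_cake[symmetric]) (auto intro!: nn_integral_mono 1)
  qed (rule 2)
  then have "integrable lborel (\<lambda>w::complex. ?G (norm w))"
    by (intro integrableI_nonneg) auto
  then have "integrable lborel (\<lambda>w::complex. (1 + R)\<^sup>2 * ?G (norm w))"
    by (intro integrable_mult_right)
  then have "integrable lborel (\<lambda>w::complex. indicator (cball 0 R) w / norm w)"
  proof (rule Bochner_Integration.integrable_bound)
    show "AE w::complex in lborel. norm (indicator (cball 0 R) w / norm w) \<le> norm ((1 + R)\<^sup>2 * ?G (norm w))"
    proof (rule AE_I2)
      fix w :: complex
      show "norm (indicator (cball 0 R) w / norm w) \<le> norm ((1 + R)\<^sup>2 * ?G (norm w))"
      proof (cases "norm w \<le> R \<and> w \<noteq> 0")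
        case True
        then have "(1 + norm w)\<^sup>2 \<le> (1 + R)\<^sup>2" by (intro power_mono) auto
        moreover have "(1 + norm w)\<^sup>2 > 0" by (intro zero_less_power add_pos_nonneg) auto
        ultimately show ?thesis using True by (auto simp: field_simps)
      qed (auto simp: indicator_def)
    qed
  qed (use meas in simp)
  then have "integrable lborel (\<lambda>w. (\<lambda>u::complex. indicator (cball 0 R) u / norm u) (- z + w))"
    by (subst integral_lborel_translate(2)[OF meas])
  moreover have "(\<lambda>w. (\<lambda>u::complex. indicator (cball 0 R) u / norm u) (- z + w))
      = (\<lambda>w. indicator (cball z R) w / norm (w - z))"
    by (auto simp: fun_eq_iff indicator_def dist_norm norm_minus_commute)
  ultimately show ?thesis by simp
qed

lemma integrable_cauchy_kernel:
  fixes g :: "complex \<Rightarrow> complex"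
  assumes [measurable]: "g \<in> borel_measurable borel"
    and B: "\<And>w. norm (g w) \<le> B" and R: "\<And>w. norm w > R \<Longrightarrow> g w = 0"
  shows "integrable lborel (\<lambda>w. g w / (w - z))"
proof (rule Bochner_Integration.integrable_bound)
  \<comment> \<open>The disc about \<open>z\<close> of radius \<open>R + norm z\<close> contains the
    disc about 0 of radius \<open>R\<close>, outside which \<open>g\<close> vanishes.\<close>
  show "integrable lborel (\<lambda>w. B * (indicator (cball z (R + norm z)) w / norm (w - z)))"
    by (intro integrable_mult_right integrable_inverse_norm_complex)
  show "AE w in lborel. norm (g w / (w - z)) \<le> norm (B * (indicator (cball z (R + norm z)) w / norm (w - z)))"
  proof (rule AE_I2)
    fix w
    show "norm (g w / (w - z)) \<le> norm (B * (indicator (cball z (R + norm z)) w / norm (w - z)))"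
    proof (cases "w \<in> cball z (R + norm z)")
      case True
      then show ?thesis using B[of w]
        by (auto simp: norm_divide abs_mult intro!: divide_right_mono)
    next
      case False
      then have "norm w > R" using norm_triangle_ineq4[of z w] by (auto simp: dist_norm)
      then show ?thesis using R by simp
    qed
  qed
qed simp

section \<open>The Cauchy--Pompeiu formula for compact support\<close>

text \<open>The singular kernel \<open>1 / w\<close> is the limit of \<open>cnj w / (c\<^sup>2 + \<bar>w\<bar>\<^sup>2)\<close> as \<open>c \<rightarrow> 0\<close>, whose
  antiholomorphic derivative is the approximate identity \<open>c\<^sup>2 / (c\<^sup>2 + \<bar>w\<bar>\<^sup>2)\<^sup>2\<close> of mass \<open>\<pi>\<close>. Scaling by
  \<open>c\<close> reduces it to the fixed kernel \<open>k\<close> below.\<close>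

lemma cauchy_pompeiu_0:
  fixes \<phi> :: "complex \<Rightarrow> complex"
  assumes der: "\<And>z. (\<phi> has_derivative \<phi>' z) (at z)"
    and bnd: "\<And>z h. norm (\<phi>' z h) \<le> L * norm h"
    and supp: "\<And>z. norm z > R \<Longrightarrow> \<phi> z = 0"
  shows "(\<integral>w. (\<phi>' w 1 + \<i> * \<phi>' w \<i>) / 2 / w \<partial>lborel) = - pi * \<phi> 0"
proof -
  define g where "g w = (\<phi>' w 1 + \<i> * \<phi>' w \<i>) / 2" for w
  have cont: "continuous_on UNIV \<phi>"
    by (metis der continuous_at_imp_continuous_on has_derivative_continuous)
  then have \<phi>_meas[measurable]: "\<phi> \<in> borel_measurable borel" by (rule borel_measurable_continuous_onI)
  have [measurable]: "(\<lambda>w. \<phi>' w h) \<in> borel_measurable borel" for h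
    by (rule borel_measurable_has_derivative[OF der])
  have g_meas[measurable]: "g \<in> borel_measurable borel" unfolding g_def by measurable
  have lip: "norm (\<phi> z - \<phi> w) \<le> L * norm (z - w)" for z w
    by (rule bounded_derivative_imp_lipschitz[where S = UNIV, OF _ der bnd]) auto
  have L: "L \<ge> 0" using bnd[of 0 1] by (auto intro: order_trans[OF norm_ge_zero])
  have "compact (\<phi> ` cball 0 R)"
    using cont by (intro compact_continuous_image) (auto elim: continuous_on_subset)
  then obtain B0 where B0: "norm (\<phi> z) \<le> B0" if "norm z \<le> R" for z
    by (metis compact_imp_bounded bounded_iff image_eqI mem_cball_0)
  define B where "B = max B0 0"
  have B: "norm (\<phi> z) \<le> B" for z
    using B0[of z] supp[of z] by (cases "norm z \<le> R") (auto simp: B_def)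
  have B0': "B \<ge> 0" by (simp add: B_def)
  have g_bound: "norm (g w) \<le> L" for w
  proof -
    have "norm (g w) \<le> (norm (\<phi>' w 1) + norm (\<i> * \<phi>' w \<i>)) / 2"
      unfolding g_def using norm_triangle_ineq[of "\<phi>' w 1" "\<i> * \<phi>' w \<i>"] by (simp add: norm_divide)
    also have "\<dots> \<le> (L + L) / 2"
      using bnd[of w 1] bnd[of w \<i>] by (intro divide_right_mono add_mono) (auto simp: norm_mult)
    finally show ?thesis by simp
  qed
  have \<phi>'0: "\<phi>' w h = 0" if "norm w > R" for w h
    by (rule has_derivative_locally_constant[OF der, of "- cball 0 R" w 0]) (use that supp in auto)
  have g0: "g w = 0" if "norm w > R" for w
    unfolding g_def using \<phi>'0[OF that] by simp
  define N where "N w = 1 + w \<bullet> w" for w :: complex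
  have N: "N w \<ge> 1" "N w > 0" "N w \<noteq> 0" for w
    using inner_ge_zero[of w] unfolding N_def by linarith+
  have Nn: "N w = 1 + (norm w)\<^sup>2" for w by (simp add: N_def power2_norm_eq_inner)
  have [measurable]: "cnj \<in> borel_measurable borel"
    by (intro borel_measurable_continuous_onI continuous_intros)
  have N_meas[measurable]: "N \<in> borel_measurable borel" unfolding N_def by measurable
  define k where "k w = cnj w /\<^sub>R N w" for w
  define k' where "k' w h = cnj h /\<^sub>R N w - (2 * (w \<bullet> h) / (N w)\<^sup>2) *\<^sub>R cnj w" for w h
  have k_der: "(k has_derivative k' w) (at w)" for w
  proof -
    have 1: "(N has_derivative (\<lambda>h. 2 * (w \<bullet> h))) (at w)"
      unfolding N_def by (auto intro!: derivative_eq_intros simp: inner_commute)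
    have "(k has_derivative (\<lambda>h. (inverse (N w)) *\<^sub>R cnj h + (- (inverse (N w) * (2 * (w \<bullet> h)) * inverse (N w))) *\<^sub>R cnj w)) (at w)"
      unfolding k_def
      by (rule has_derivative_scaleR[OF Deriv.has_derivative_inverse[OF N(3) 1]
            bounded_linear.has_derivative[OF bounded_linear_cnj has_derivative_ident]])
    moreover have "(\<lambda>h. (inverse (N w)) *\<^sub>R cnj h + (- (inverse (N w) * (2 * (w \<bullet> h)) * inverse (N w))) *\<^sub>R cnj w) = k' w"
      by (simp add: fun_eq_iff k'_def divide_inverse power2_eq_square ac_simps)
    ultimately show ?thesis by simp
  qed
  have k'_bound: "norm (k' w h) \<le> 3 * norm h" for w h
  proof -
    have "norm (k' w h) \<le> norm h / N w + 2 * \<bar>w \<bullet> h\<bar> / (N w)\<^sup>2 * norm w"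
      unfolding k'_def using N(2)[of w]
      by (intro order_trans[OF norm_triangle_ineq4]) (simp add: abs_mult divide_inverse mult.commute)
    also have "norm h / N w \<le> norm h" using N(1,2)[of w] mult_left_mono[of 1 "N w" "norm h"] by (simp add: divide_le_eq)
    also have "2 * \<bar>w \<bullet> h\<bar> / (N w)\<^sup>2 * norm w \<le> 2 * (norm w * norm h) / (N w)\<^sup>2 * norm w"
      using Cauchy_Schwarz_ineq2[of w h] by (intro mult_right_mono divide_right_mono) auto
    also have "\<dots> = 2 * norm h * ((norm w)\<^sup>2 / (N w)\<^sup>2)" by (simp add: power2_eq_square)
    also have "\<dots> \<le> 2 * norm h * 1"
    proof (intro mult_left_mono)
      have "(norm w)\<^sup>2 \<le> N w" by (simp add: Nn)
      also have "N w \<le> (N w)\<^sup>2" using N(1)[of w] by (simp add: power2_eq_square)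
      finally show "(norm w)\<^sup>2 / (N w)\<^sup>2 \<le> 1" using N(2)[of w] by (simp add: divide_le_eq)
    qed simp
    finally show ?thesis by simp
  qed
  have k_lip: "norm (k z - k w) \<le> 3 * norm (z - w)" for z w
    by (rule bounded_derivative_imp_lipschitz[where S = UNIV, OF _ k_der k'_bound]) auto
  have k_bound: "norm (k w) \<le> 1" for w
  proof -
    have "2 * norm w \<le> 1 + (norm w)\<^sup>2" using zero_le_power2[of "norm w - 1"] by (simp add: power2_eq_square algebra_simps)
    then have "norm w \<le> N w" using norm_ge_zero[of w] unfolding Nn by linarith
    then show ?thesis unfolding k_def using N(2)[of w] by (simp add: divide_inverse[symmetric] divide_le_eq mult.commute)
  qed
  \<comment> \<open>This is twice the antiholomorphic derivative of \<open>k\<close>: the quotient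
    rule leaves the numerator \<open>N w - w \<bullet> w\<close>, which is 1.\<close>
  have k_bar: "k' w 1 + \<i> * k' w \<i> = of_real (2 / (N w)\<^sup>2)" for w
  proof -
    define s t where "s = inverse (N w)" and "t = 2 / (N w)\<^sup>2"
    have k's: "k' w h = s *\<^sub>R cnj h - (t * (w \<bullet> h)) *\<^sub>R cnj w" for h
      by (simp add: k'_def s_def t_def)
    have "w \<bullet> 1 = Re w" "w \<bullet> \<i> = Im w" by (simp_all add: inner_complex_def)
    moreover have "w \<bullet> w = (Re w)\<^sup>2 + (Im w)\<^sup>2" by (simp add: inner_complex_def power2_eq_square)
    ultimately have "k' w 1 + \<i> * k' w \<i> = of_real (2 * s) - of_real (t * (w \<bullet> w))"
      unfolding k's by (simp add: complex_eq_iff power2_eq_square algebra_simps)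
    also have "\<dots> = of_real (2 / N w) - of_real (2 * (w \<bullet> w) / (N w)\<^sup>2)"
      by (simp add: s_def t_def divide_inverse)
    also have "\<dots> = of_real (2 / (N w)\<^sup>2)"
    proof -
      have "w \<bullet> w = N w - 1" by (simp add: N_def)
      then have "2 / N w - 2 * (w \<bullet> w) / (N w)\<^sup>2 = 2 / (N w)\<^sup>2"
        using N(3)[of w] by (simp add: divide_simps) (simp add: power2_eq_square algebra_simps)
      then show ?thesis by (metis of_real_diff)
    qed
    finally show ?thesis .
  qed
  have k_meas[measurable]: "k \<in> borel_measurable borel"
    by (intro borel_measurable_continuous_onI) (metis k_der continuous_at_imp_continuous_on has_derivative_continuous)
  have intN: "integrable lborel (\<lambda>w. 1 / (N w)\<^sup>2)" "(\<integral>w. 1 / (N w)\<^sup>2 \<partial>lborel) = pi"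
    unfolding Nn by (rule integral_inverse_square_one_plus_norm_square)+
  have intB: "integrable lborel (\<lambda>w. B * (1 / (N w)\<^sup>2))"
    by (intro integrable_mult_right intN)
  have int\<phi>: "integrable lborel (\<lambda>w. \<phi> (c *\<^sub>R w) * of_real (1 / (N w)\<^sup>2))" for c :: real
  proof (rule Bochner_Integration.integrable_bound[of _ "\<lambda>w. B * (1 / (N w)\<^sup>2)"])
    show "AE w in lborel. norm (\<phi> (c *\<^sub>R w) * of_real (1 / (N w)\<^sup>2)) \<le> norm (B * (1 / (N w)\<^sup>2))"
      using B B0' by (intro AE_I2) (auto simp: norm_mult norm_divide norm_power abs_mult intro!: mult_right_mono divide_right_mono)
  qed (use intB in auto)

  \<comment> \<open>The antiholomorphic derivative of the compactly supported product
    \<open>\<phi> (c *\<^sub>R w) * k w\<close> integrates to 0, and the product rule splits it into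
    a mass term and a kernel term. Rescaling the latter brings the Jacobian \<open>c\<^sup>2\<close>
    and a factor \<open>1 / c\<close> from the kernel, matching the factor \<open>c\<close> of the
    chain rule.\<close>
  have key: "(\<integral>w. \<phi> (c *\<^sub>R w) * of_real (1 / (N w)\<^sup>2) \<partial>lborel) = - (\<integral>w. g w * (cnj w / of_real (c\<^sup>2 + (norm w)\<^sup>2)) \<partial>lborel)"
    if c: "c > 0" for c :: real
  proof -
    define \<Psi>' where "\<Psi>' w h = \<phi> (c *\<^sub>R w) * k' w h + \<phi>' (c *\<^sub>R w) (c *\<^sub>R h) * k w" for w h
    have d: "((\<lambda>w. \<phi> (c *\<^sub>R w) * k w) has_derivative \<Psi>' w) (at w)" for w
      unfolding \<Psi>'_def
      by (rule has_derivative_mult[OF has_derivative_compose[OF _ der] k_der])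
         (auto intro!: derivative_eq_intros)
    have l: "norm (\<phi> (c *\<^sub>R z) * k z - \<phi> (c *\<^sub>R w) * k w) \<le> (L * c + B * 3) * norm (z - w)" for z w
    proof -
      have "\<phi> (c *\<^sub>R z) * k z - \<phi> (c *\<^sub>R w) * k w = (\<phi> (c *\<^sub>R z) - \<phi> (c *\<^sub>R w)) * k z + \<phi> (c *\<^sub>R w) * (k z - k w)"
        by (simp add: algebra_simps)
      also have "norm \<dots> \<le> norm (\<phi> (c *\<^sub>R z) - \<phi> (c *\<^sub>R w)) * norm (k z) + norm (\<phi> (c *\<^sub>R w)) * norm (k z - k w)"
        by (intro order_trans[OF norm_triangle_ineq]) (simp add: norm_mult)
      also have "\<dots> \<le> (L * norm (c *\<^sub>R z - c *\<^sub>R w)) * 1 + B * (3 * norm (z - w))"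
        by (intro add_mono mult_mono lip k_bound B k_lip) (use L B0' in auto)
      also have "norm (c *\<^sub>R z - c *\<^sub>R w) = c * norm (z - w)"
        using c by (simp flip: scaleR_diff_right)
      finally show ?thesis by (simp add: algebra_simps)
    qed
    have s: "\<phi> (c *\<^sub>R w) * k w = 0" if "norm w > R / c" for w
      using that c supp[of "c *\<^sub>R w"] by (simp add: divide_less_eq mult.commute)
    have I: "integrable lborel (\<lambda>w. \<Psi>' w h)" "(\<integral>w. \<Psi>' w h \<partial>lborel) = 0" for h
      using integral_has_derivative_compact_support[OF d l s] by auto
    have "(\<integral>w. \<Psi>' w 1 + \<i> * \<Psi>' w \<i> \<partial>lborel) = 0"
      using I by simp
    moreover have "\<Psi>' w 1 + \<i> * \<Psi>' w \<i> = 2 * (\<phi> (c *\<^sub>R w) * of_real (1 / (N w)\<^sup>2) + of_real c * (g (c *\<^sub>R w) * k w))" for w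
    proof -
      have lin: "\<phi>' (c *\<^sub>R w) (c *\<^sub>R h) = of_real c * \<phi>' (c *\<^sub>R w) h" for h
        using linear_cmul[OF has_derivative_linear[OF der], of "c *\<^sub>R w" c h] by (simp add: scaleR_conv_of_real)
      have "\<Psi>' w 1 + \<i> * \<Psi>' w \<i> = \<phi> (c *\<^sub>R w) * (k' w 1 + \<i> * k' w \<i>)
          + of_real c * (\<phi>' (c *\<^sub>R w) 1 + \<i> * \<phi>' (c *\<^sub>R w) \<i>) * k w"
        unfolding \<Psi>'_def lin by (simp add: algebra_simps)
      then show ?thesis unfolding k_bar g_def by simp
    qed
    ultimately have "2 * (\<integral>w. \<phi> (c *\<^sub>R w) * of_real (1 / (N w)\<^sup>2) + of_real c * (g (c *\<^sub>R w) * k w) \<partial>lborel) = 0"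
      by (simp only: Bochner_Integration.integral_mult_right_zero)
    then have z: "(\<integral>w. \<phi> (c *\<^sub>R w) * of_real (1 / (N w)\<^sup>2) + of_real c * (g (c *\<^sub>R w) * k w) \<partial>lborel) = 0"
      using mult_eq_0_iff[THEN iffD1] zero_neq_numeral[symmetric] by blast
    have gk: "integrable lborel (\<lambda>w. g (c *\<^sub>R w) * k w)"
    proof (rule integrableI_bounded_support[where B = "L * 1" and R = "R / c"])
      show "norm (g (c *\<^sub>R w) * k w) \<le> L * 1" for w
        unfolding norm_mult by (intro mult_mono g_bound k_bound L) auto
      show "g (c *\<^sub>R w) * k w = 0" if "norm w > R / c" for w
        using that c g0[of "c *\<^sub>R w"] by (simp add: divide_less_eq mult.commute)
    qed measurable
    have "(\<integral>w. \<phi> (c *\<^sub>R w) * of_real (1 / (N w)\<^sup>2) \<partial>lborel) = - (of_real c * (\<integral>w. g (c *\<^sub>R w) * k w \<partial>lborel))"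
      by (rule eq_neg_iff_add_eq_0[THEN iffD2,
            OF z[unfolded Bochner_Integration.integral_add[OF int\<phi>[of c] integrable_mult_right[OF gk, of "of_real c"]]
              Bochner_Integration.integral_mult_right_zero]])
    also have "of_real c * (\<integral>w. g (c *\<^sub>R w) * k w \<partial>lborel) = (\<integral>w. g w * (cnj w / of_real (c\<^sup>2 + (norm w)\<^sup>2)) \<partial>lborel)"
    proof -
      have eq: "g (c *\<^sub>R w) * (cnj (c *\<^sub>R w) / of_real (c\<^sup>2 + (norm (c *\<^sub>R w))\<^sup>2)) = g (c *\<^sub>R w) * k w / of_real c" for w
      proof -
        have "c\<^sup>2 + (norm (c *\<^sub>R w))\<^sup>2 = c\<^sup>2 * N w" by (simp add: Nn power_mult_distrib algebra_simps)
        moreover have "k w = cnj w / of_real (N w)"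
          by (simp add: k_def scaleR_conv_of_real divide_inverse mult.commute)
        moreover have "cnj (c *\<^sub>R w) = of_real c * cnj w" by (simp add: scaleR_conv_of_real)
        ultimately show ?thesis using c N(3)[of w]
          by (simp only: of_real_mult of_real_power) (simp add: power2_eq_square)
      qed
      have m: "(\<lambda>w. g w * (cnj w / of_real (c\<^sup>2 + (norm w)\<^sup>2))) \<in> borel_measurable borel"
        by measurable
      have "(\<integral>w. g w * (cnj w / of_real (c\<^sup>2 + (norm w)\<^sup>2)) \<partial>lborel)
          = c\<^sup>2 *\<^sub>R (\<integral>w. g (c *\<^sub>R w) * k w / of_real c \<partial>lborel)"
        by (subst integral_lborel_scale[OF m c]) (simp only: eq DIM_complex)
      also have "\<dots> = of_real c * (\<integral>w. g (c *\<^sub>R w) * k w \<partial>lborel)"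
        using c by (simp add: scaleR_conv_of_real power2_eq_square)
      finally show ?thesis by simp
    qed
    finally show ?thesis .
  qed

  define c where "c n = 1 / real (Suc n)" for n
  have c: "c n > 0" for n by (simp add: c_def)
  have cl: "c \<longlonglongrightarrow> 0" unfolding c_def using LIMSEQ_Suc[OF lim_inverse_n'] .
  \<comment> \<open>The mass term concentrates at the origin: by continuity the first factor tends
    to \<open>\<phi> 0\<close>, under the integrable bound
    \<open>B * (1 / (N w)\<^sup>2)\<close>.\<close>
  have "(\<lambda>n. \<integral>w. \<phi> (c n *\<^sub>R w) * of_real (1 / (N w)\<^sup>2) \<partial>lborel) \<longlonglongrightarrow> (\<integral>w. \<phi> (0 *\<^sub>R w) * of_real (1 / (N w)\<^sup>2) \<partial>lborel)"
  proof (rule integral_dominated_convergence[where w = "\<lambda>w. B * (1 / (N w)\<^sup>2)"])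
    show "AE w in lborel. (\<lambda>n. \<phi> (c n *\<^sub>R w) * of_real (1 / (N w)\<^sup>2)) \<longlonglongrightarrow> \<phi> (0 *\<^sub>R w) * of_real (1 / (N w)\<^sup>2)"
    proof (intro AE_I2 tendsto_mult tendsto_const)
      fix w
      have "isCont \<phi> (0 *\<^sub>R w)" using cont by (simp add: continuous_on_eq_continuous_at)
      then show "(\<lambda>n. \<phi> (c n *\<^sub>R w)) \<longlonglongrightarrow> \<phi> (0 *\<^sub>R w)"
        by (rule isCont_tendsto_compose) (intro tendsto_intros cl)
    qed
    show "AE w in lborel. norm (\<phi> (c n *\<^sub>R w) * of_real (1 / (N w)\<^sup>2)) \<le> B * (1 / (N w)\<^sup>2)" for n
      using B B0' by (intro AE_I2) (auto simp: norm_mult norm_divide norm_power intro!: mult_right_mono divide_right_mono)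
  qed (use intB in auto)
  also have "(\<integral>w. \<phi> (0 *\<^sub>R w) * of_real (1 / (N w)\<^sup>2) \<partial>lborel) = \<phi> 0 * of_real pi"
    by (simp only: scaleR_zero_left Bochner_Integration.integral_mult_right_zero integral_complex_of_real intN(2))
  finally have 1: "(\<lambda>n. \<integral>w. \<phi> (c n *\<^sub>R w) * of_real (1 / (N w)\<^sup>2) \<partial>lborel) \<longlonglongrightarrow> \<phi> 0 * of_real pi" .
  \<comment> \<open>Uniformly in \<open>n\<close> the regularised kernels are bounded by
    \<open>1 / norm w\<close>, which is integrable on the disc containing the support of
    \<open>g\<close>.\<close>
  have 2: "(\<lambda>n. \<integral>w. g w * (cnj w / of_real ((c n)\<^sup>2 + (norm w)\<^sup>2)) \<partial>lborel) \<longlonglongrightarrow> (\<integral>w. g w / w \<partial>lborel)"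
  proof (rule integral_dominated_convergence[where w = "\<lambda>w. L * (indicator (cball 0 R) w / norm (w - 0))"])
    show "integrable lborel (\<lambda>w::complex. L * (indicator (cball 0 R) w / norm (w - 0)))"
      by (intro integrable_mult_right integrable_inverse_norm_complex)
    show "AE w in lborel. (\<lambda>n. g w * (cnj w / of_real ((c n)\<^sup>2 + (norm w)\<^sup>2))) \<longlonglongrightarrow> g w / w"
    proof (rule AE_I2)
      fix w
      show "(\<lambda>n. g w * (cnj w / of_real ((c n)\<^sup>2 + (norm w)\<^sup>2))) \<longlonglongrightarrow> g w / w"
      proof (cases "w = 0")
        case False
        have "(\<lambda>n. g w * (cnj w / of_real ((c n)\<^sup>2 + (norm w)\<^sup>2))) \<longlonglongrightarrow> g w * (cnj w / of_real (0\<^sup>2 + (norm w)\<^sup>2))"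
          using False by (intro tendsto_intros cl) (auto simp flip: of_real_power)
        also have "cnj w / of_real (0\<^sup>2 + (norm w)\<^sup>2) = 1 / w"
          using False complex_norm_square[of w] by (simp add: field_simps)
        finally show ?thesis by simp
      qed simp
    qed
    show "AE w in lborel. norm (g w * (cnj w / of_real ((c n)\<^sup>2 + (norm w)\<^sup>2))) \<le> L * (indicator (cball 0 R) w / norm (w - 0))" for n
    proof (rule AE_I2)
      fix w
      show "norm (g w * (cnj w / of_real ((c n)\<^sup>2 + (norm w)\<^sup>2))) \<le> L * (indicator (cball 0 R) w / norm (w - 0))"
      proof (cases "w \<noteq> 0 \<and> norm w \<le> R")
        case True
        have p: "(c n)\<^sup>2 + (norm w)\<^sup>2 > 0" using c[of n] by (simp add: add_pos_nonneg)
        have "norm (cnj w / complex_of_real ((c n)\<^sup>2 + (norm w)\<^sup>2)) = norm w / ((c n)\<^sup>2 + (norm w)\<^sup>2)"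
          unfolding norm_divide norm_of_real using p by simp
        also have "\<dots> \<le> norm w / (norm w)\<^sup>2"
          using True p by (intro divide_left_mono) auto
        also have "\<dots> = 1 / norm w" by (simp add: power2_eq_square)
        finally have "norm (g w * (cnj w / of_real ((c n)\<^sup>2 + (norm w)\<^sup>2))) \<le> L * (1 / norm w)"
          unfolding norm_mult by (intro mult_mono g_bound L) auto
        then show ?thesis using True by simp
      next
        case False
        then show ?thesis using g0[of w] L by (auto simp: indicator_def)
      qed
    qed
  qed measurable
  have "\<phi> 0 * of_real pi = - (\<integral>w. g w / w \<partial>lborel)"
    using LIMSEQ_unique[OF 1] tendsto_minus[OF 2] unfolding key[OF c] by blast
  then show ?thesis unfolding g_def by (simp add: minus_equation_iff mult.commute)
qed

lemma cauchy_pompeiu: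
  fixes \<phi> :: "complex \<Rightarrow> complex"
  assumes der: "\<And>z. (\<phi> has_derivative \<phi>' z) (at z)"
    and bnd: "\<And>z h. norm (\<phi>' z h) \<le> L * norm h"
    and supp: "\<And>z. norm z > R \<Longrightarrow> \<phi> z = 0"
  shows "(\<integral>w. (\<phi>' w 1 + \<i> * \<phi>' w \<i>) / 2 / (w - z) \<partial>lborel) = - pi * \<phi> z"
proof -
  have [measurable]: "(\<lambda>w. \<phi>' w h) \<in> borel_measurable borel" for h
    by (rule borel_measurable_has_derivative[OF der])
  have "(\<integral>w. (\<phi>' w 1 + \<i> * \<phi>' w \<i>) / 2 / (w - z) \<partial>lborel)
      = (\<integral>w. (\<phi>' (z + w) 1 + \<i> * \<phi>' (z + w) \<i>) / 2 / w \<partial>lborel)"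
    by (subst integral_lborel_translate(1)[of _ z, symmetric]) auto
  also have "\<dots> = - pi * \<phi> (z + 0)"
  proof (rule cauchy_pompeiu_0)
    show "((\<lambda>w. \<phi> (z + w)) has_derivative \<phi>' (z + w)) (at w)" for w
      by (rule has_derivative_compose[OF _ der, where f' = "\<lambda>h. h", simplified])
         (auto intro!: derivative_eq_intros)
    show "\<phi> (z + w) = 0" if "norm w > R + norm z" for w
      by (rule supp) (use that norm_diff_ineq[of w z] in \<open>simp add: add.commute\<close>)
  qed (rule bnd)
  finally show ?thesis by simp
qed

section \<open>Double Cauchy kernels and cutoff functions\<close>

lemma borel_measurable_fst_snd [measurable]:
  "(fst :: 'a::topological_space \<times> 'b::topological_space \<Rightarrow> 'a) \<in> borel_measurable borel"
  "(snd :: 'a \<times> 'b \<Rightarrow> 'b) \<in> borel_measurable borel"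
  by (intro borel_measurable_continuous_onI continuous_intros)+

lemma integrable_lborel_mult_prod:
  fixes u :: "'a::euclidean_space \<Rightarrow> real" and v :: "'b::euclidean_space \<Rightarrow> real"
  assumes u: "integrable lborel u" and v: "integrable lborel v"
  shows "integrable lborel (\<lambda>p. u (fst p) * v (snd p))"
proof -
  have [measurable]: "u \<in> borel_measurable borel" "v \<in> borel_measurable borel"
    using borel_measurable_integrable[OF u] borel_measurable_integrable[OF v] by simp_all
  have "integrable (lborel \<Otimes>\<^sub>M lborel) (\<lambda>p. u (fst p) * v (snd p))"
  proof (rule lborel_pair.Fubini_integrable)
    show "(\<lambda>p. u (fst p) * v (snd p)) \<in> borel_measurable (lborel \<Otimes>\<^sub>M lborel)" by measurable
    show "integrable lborel (\<lambda>x. \<integral>y. norm (u (fst (x, y)) * v (snd (x, y))) \<partial>lborel)"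
      using u v by (simp add: abs_mult)
    show "AE x in lborel. integrable lborel (\<lambda>y. u (fst (x, y)) * v (snd (x, y)))"
      using v by simp
  qed
  then show ?thesis by (simp add: lborel_prod)
qed

lemma integral_lborel_prod:
  fixes f :: "'a::euclidean_space \<times> 'b::euclidean_space \<Rightarrow> 'c::{banach, second_countable_topology}"
  assumes "integrable lborel f"
  shows "(\<integral>p. f p \<partial>lborel) = (\<integral>x. \<integral>y. f (x, y) \<partial>lborel \<partial>lborel)"
    and "(\<integral>p. f p \<partial>lborel) = (\<integral>y. \<integral>x. f (x, y) \<partial>lborel \<partial>lborel)"
proof -
  have i: "integrable (lborel \<Otimes>\<^sub>M lborel) f" using assms by (simp add: lborel_prod)
  show "(\<integral>p. f p \<partial>lborel) = (\<integral>x. \<integral>y. f (x, y) \<partial>lborel \<partial>lborel)"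
    using lborel_pair.integral_fst'[OF i] by (simp add: lborel_prod)
  show "(\<integral>p. f p \<partial>lborel) = (\<integral>y. \<integral>x. f (x, y) \<partial>lborel \<partial>lborel)"
    using lborel_pair.integral_snd[of "\<lambda>x y. f (x, y)"] i by (simp add: lborel_prod)
qed

text \<open>A rectangle contains the support, so the bound is a product of two one-variable kernels,
  each integrable on its disc.\<close>

lemma integrable_double_cauchy_kernel:
  fixes g :: "complex \<times> complex \<Rightarrow> complex"
  assumes [measurable]: "g \<in> borel_measurable borel"
    and B: "\<And>p. norm (g p) \<le> B"
    and R: "\<And>p. norm (fst p) > R \<or> norm (snd p) > R \<Longrightarrow> g p = 0"
  shows "integrable lborel (\<lambda>p. g p / ((fst p - z1) * (snd p - z2)))"
proof (rule Bochner_Integration.integrable_bound)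
  let ?u = "\<lambda>z w. indicator (cball z (R + norm z)) w / norm (w - z)"
  show "integrable lborel (\<lambda>p. B * (?u z1 (fst p) * ?u z2 (snd p)))"
    by (intro integrable_mult_right integrable_lborel_mult_prod integrable_inverse_norm_complex)
  show "AE p in lborel. norm (g p / ((fst p - z1) * (snd p - z2))) \<le> norm (B * (?u z1 (fst p) * ?u z2 (snd p)))"
  proof (rule AE_I2)
    fix p :: "complex \<times> complex"
    have in_cball: "w \<in> cball z (R + norm z)" if "norm w \<le> R" for w z :: complex
      using that norm_triangle_ineq4[of z w] by (auto simp: dist_norm)
    show "norm (g p / ((fst p - z1) * (snd p - z2))) \<le> norm (B * (?u z1 (fst p) * ?u z2 (snd p)))"
    proof (cases "norm (fst p) \<le> R \<and> norm (snd p) \<le> R")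
      case True
      then have "fst p \<in> cball z1 (R + norm z1)" "snd p \<in> cball z2 (R + norm z2)"
        by (auto intro: in_cball simp del: mem_cball)
      then have "norm (B * (?u z1 (fst p) * ?u z2 (snd p))) = \<bar>B\<bar> / (norm (fst p - z1) * norm (snd p - z2))"
        by (simp add: abs_mult)
      moreover have "norm (g p) \<le> \<bar>B\<bar>" using B[of p] by linarith
      ultimately show ?thesis
        by (simp only: norm_divide norm_mult) (intro divide_right_mono, auto)
    qed (use R[of p] in auto)
  qed
qed measurable

text \<open>A point \<open>\<zeta>\<close> at distance at least \<open>r\<close> from
  \<open>c\<close> stays at distance at least \<open>r / 2\<close> from every \<open>z\<close> in
  the half-radius disc, so the kernel is harmless there. The Lipschitz constant is the product of
  the bounds \<open>2 / r\<close> and \<open>1 / r\<close> for the kernel at \<open>z\<close> and at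
  \<open>c\<close>.\<close>

lemma inverse_cutoff_kernel:
  fixes \<zeta> c z :: complex
  assumes r: "r > 0" and \<zeta>: "norm (\<zeta> - c) \<ge> r" and z: "norm (z - c) < r / 2"
  shows "norm (1 / (\<zeta> - z)) \<le> 2 / r"
    and "norm (1 / (\<zeta> - z) - 1 / (\<zeta> - c)) \<le> 2 / r\<^sup>2 * norm (z - c)"
    and "((\<lambda>z. 1 / (\<zeta> - z)) has_derivative (\<lambda>h. h / (\<zeta> - c)\<^sup>2)) (at c)"
proof -
  have n: "norm (\<zeta> - z) \<ge> r / 2"
    using norm_triangle_ineq2[of "\<zeta> - c" "z - c"] \<zeta> z by simp
  have nz: "\<zeta> - z \<noteq> 0" "\<zeta> - c \<noteq> 0" using n \<zeta> r by auto
  show 1: "norm (1 / (\<zeta> - z)) \<le> 2 / r"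
    using divide_left_mono[OF n, of 1] r nz by (simp add: norm_divide)
  have 2: "norm (1 / (\<zeta> - c)) \<le> 1 / r"
    using divide_left_mono[OF \<zeta>, of 1] r nz by (simp add: norm_divide)
  have "1 / (\<zeta> - z) - 1 / (\<zeta> - c) = (1 / (\<zeta> - z)) * (1 / (\<zeta> - c)) * (z - c)"
    using nz by (simp add: divide_simps)
  then have "norm (1 / (\<zeta> - z) - 1 / (\<zeta> - c)) = norm (1 / (\<zeta> - z)) * norm (1 / (\<zeta> - c)) * norm (z - c)"
    by (simp only: norm_mult)
  also have "\<dots> \<le> (2 / r) * (1 / r) * norm (z - c)"
    using r by (intro mult_right_mono mult_mono 1 2) auto
  finally show "norm (1 / (\<zeta> - z) - 1 / (\<zeta> - c)) \<le> 2 / r\<^sup>2 * norm (z - c)"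
    by (simp add: power2_eq_square)
  have "((\<lambda>z. 1 / (\<zeta> - z)) has_field_derivative 1 / (\<zeta> - c)\<^sup>2) (at c)"
    using nz by (auto intro!: derivative_eq_intros simp: power2_eq_square)
  then show "((\<lambda>z. 1 / (\<zeta> - z)) has_derivative (\<lambda>h. h / (\<zeta> - c)\<^sup>2)) (at c)"
    unfolding has_field_derivative_def by (rule has_derivative_eq_rhs) (simp add: fun_eq_iff)
qed

text \<open>The truncated square is the gluing function for the cutoffs; at 0 its difference
  quotient is at most \<open>\<bar>h\<bar>\<close>.\<close>

lemma has_real_derivative_square_max_0:
  "((\<lambda>x::real. (max 0 x)\<^sup>2) has_real_derivative 2 * max 0 x) (at x)"
proof (cases "x = 0")
  case True
  have "((\<lambda>h::real. (max 0 h)\<^sup>2 / h) \<longlongrightarrow> 0) (at 0)"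
  proof (rule Lim_null_comparison)
    show "\<forall>\<^sub>F h::real in at 0. norm ((max 0 h)\<^sup>2 / h) \<le> \<bar>h\<bar>"
      by (intro always_eventually allI) (auto simp: max_def power2_eq_square)
    show "((\<lambda>h::real. \<bar>h\<bar>) \<longlongrightarrow> 0) (at 0)"
      by (auto intro!: tendsto_eq_intros)
  qed
  then show ?thesis using True by (simp add: DERIV_def)
next
  case False
  show ?thesis
  proof (cases "x > 0")
    case True
    have "((\<lambda>x::real. x\<^sup>2) has_real_derivative 2 * max 0 x) (at x)"
      using True by (auto intro!: derivative_eq_intros)
    then show ?thesis
      by (rule has_field_derivative_transform_within_open[where S = "{0<..}"]) (use True in auto)
  next
    case neg: False
    have "((\<lambda>x::real. 0) has_real_derivative 2 * max 0 x) (at x)"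
      using neg False by simp
    then show ?thesis
      by (rule has_field_derivative_transform_within_open[where S = "{..<0}"]) (use neg False in auto)
  qed
qed

section \<open>Continuously differentiable cutoff functions and their antiholomorphic
  derivatives\<close>

locale cutoff =
  fixes D :: "complex set" and c :: complex and \<theta> :: "complex \<Rightarrow> complex"
    and \<theta>' :: "complex \<Rightarrow> complex \<Rightarrow> complex" and r s L :: real
  assumes r: "r > 0"
    and der: "\<And>z. (\<theta> has_derivative \<theta>' z) (at z)"
    and bnd': "\<And>z h. norm (\<theta>' z h) \<le> L * norm h"
    and bnd: "\<And>z. norm (\<theta> z) \<le> 1"
    and one: "\<And>z. z \<in> ball c r \<Longrightarrow> \<theta> z = 1"
    and zero: "\<And>z. z \<notin> cball c s \<Longrightarrow> \<theta> z = 0"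
    and ball: "ball c r \<subseteq> D"
    and cball: "cball c s \<subseteq> D"

text \<open>With \<open>\<rho>\<close> the truncated square,
  \<open>\<rho> (1 - \<rho> (q z))\<close> is 1 where \<open>q z \<le> 0\<close>, that is within
  distance \<open>r\<close> of \<open>c\<close>, and 0 where \<open>q z \<ge> 1\<close>, that is
  beyond distance sqrt 2 times \<open>r\<close>. The choice \<open>s = 2 * r\<close> leaves room for
  the latter.\<close>

lemma cutoff_exists:
  assumes "open D" "c \<in> D"
  obtains \<theta> \<theta>' r s L where "cutoff D c \<theta> \<theta>' r s L"
proof -
  obtain s where s: "s > 0" "cball c s \<subseteq> D"
    using assms open_contains_cball by blast
  define r where "r = s / 2"
  have r: "r > 0" "s = 2 * r" using s by (simp_all add: r_def)
  define \<rho> :: "real \<Rightarrow> real" where "\<rho> x = (max 0 x)\<^sup>2" for x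
  define q where "q z = ((z - c) \<bullet> (z - c)) / r\<^sup>2 - 1" for z
  define \<eta> where "\<eta> z = \<rho> (1 - \<rho> (q z))" for z
  define \<eta>' where "\<eta>' z h = - (2 * max 0 (1 - \<rho> (q z)) * (2 * max 0 (q z) * (2 * ((z - c) \<bullet> h) / r\<^sup>2)))" for z h
  have \<rho>_der: "(\<rho> has_derivative (\<lambda>h. 2 * max 0 x * h)) (at x)" for x
    using has_real_derivative_square_max_0[of x] unfolding has_field_derivative_def \<rho>_def .
  have q_der: "(q has_derivative (\<lambda>h. 2 * ((z - c) \<bullet> h) / r\<^sup>2)) (at z)" for z
  proof -
    have "((\<lambda>z. k * ((z - c) \<bullet> (z - c)) - 1) has_derivative (\<lambda>h. k * (2 * ((z - c) \<bullet> h)))) (at z)" for k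
      by (auto intro!: derivative_eq_intros simp: inner_commute)
    from this[of "1 / r\<^sup>2"] show ?thesis by (simp add: q_def[abs_def])
  qed
  have \<eta>_der: "(\<eta> has_derivative \<eta>' z) (at z)" for z
  proof -
    have "((\<lambda>z. 1 - \<rho> (q z)) has_derivative (\<lambda>h. 0 - 2 * max 0 (q z) * (2 * ((z - c) \<bullet> h) / r\<^sup>2))) (at z)"
      by (rule has_derivative_diff[OF has_derivative_const has_derivative_compose[OF q_der \<rho>_der]])
    from has_derivative_compose[OF this \<rho>_der] show ?thesis
      unfolding \<eta>_def \<eta>'_def by simp
  qed
  have nq: "(norm (z - c))\<^sup>2 = r\<^sup>2 * (1 + q z)" for z
    using r by (simp add: q_def power2_norm_eq_inner)
  have \<rho>0: "\<rho> x \<ge> 0" for x by (simp add: \<rho>_def)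
  \<comment> \<open>Outside \<open>0 < q z < 1\<close> one factor of the derivative vanishes.
    Inside, two factors are at most 2 and the gradient of \<open>q\<close> is estimated with
    \<open>norm (z - c) \<le> 2 * r\<close>, giving
    \<open>2 * 2 * (2 * (2 * r) / r\<^sup>2) = 16 / r\<close>.\<close>
  have \<eta>'_bound: "\<bar>\<eta>' z h\<bar> \<le> 16 / r * norm h" for z h
  proof (cases "\<rho> (q z) < 1 \<and> q z > 0")
    case True
    then have q1: "q z < 1" by (auto simp: \<rho>_def power_less_one_iff abs_square_less_1)
    have "(norm (z - c))\<^sup>2 \<le> (2 * r)\<^sup>2"
      unfolding nq using q1 mult_left_mono[of "1 + q z" 4 "r\<^sup>2"] by (simp add: power_mult_distrib)
    then have nz: "norm (z - c) \<le> 2 * r" by (rule power2_le_imp_le) (use r in simp)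
    have "\<bar>(z - c) \<bullet> h\<bar> \<le> 2 * r * norm h"
      using Cauchy_Schwarz_ineq2[of "z - c" h] mult_right_mono[OF nz, of "norm h"] by simp
    then have "\<bar>2 * ((z - c) \<bullet> h) / r\<^sup>2\<bar> \<le> 2 * (2 * r * norm h) / r\<^sup>2"
      unfolding abs_divide abs_mult by (simp add: divide_right_mono)
    moreover have "\<bar>2 * max 0 (1 - \<rho> (q z))\<bar> \<le> 2" "\<bar>2 * max 0 (q z)\<bar> \<le> 2"
      using True q1 \<rho>0[of "q z"] by auto
    ultimately have "\<bar>2 * max 0 (1 - \<rho> (q z))\<bar> * (\<bar>2 * max 0 (q z)\<bar> * \<bar>2 * ((z - c) \<bullet> h) / r\<^sup>2\<bar>)
        \<le> 2 * (2 * (2 * (2 * r * norm h) / r\<^sup>2))"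
      by (intro mult_mono) auto
    also have "\<dots> = 16 / r * norm h" using r by (simp add: power2_eq_square)
    finally show ?thesis unfolding \<eta>'_def by (simp only: abs_mult abs_minus_cancel)
  next
    case False
    then have "\<eta>' z h = 0" unfolding \<eta>'_def by auto
    then show ?thesis using r by simp
  qed
  show ?thesis
  proof (rule that[of "\<lambda>z. of_real (\<eta> z)" "\<lambda>z h. of_real (\<eta>' z h)" r s "16 / r"], unfold_locales)
    show "r > 0" by (rule r)
    show "((\<lambda>z. complex_of_real (\<eta> z)) has_derivative (\<lambda>h. of_real (\<eta>' z h))) (at z)" for z
      by (rule bounded_linear.has_derivative[OF bounded_linear_of_real \<eta>_der])
    show "norm (complex_of_real (\<eta>' z h)) \<le> 16 / r * norm h" for z h
      using \<eta>'_bound by simp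
    show "norm (complex_of_real (\<eta> z)) \<le> 1" for z
    proof -
      have "(max 0 (1 - \<rho> (q z)))\<^sup>2 \<le> 1" by (rule power_le_one) (use \<rho>0[of "q z"] in auto)
      then have "0 \<le> \<eta> z" "\<eta> z \<le> 1" by (simp_all add: \<eta>_def \<rho>_def[of "1 - _"])
      then show ?thesis by (simp only: norm_of_real abs_of_nonneg)
    qed
    show "complex_of_real (\<eta> z) = 1" if "z \<in> ball c r" for z
    proof -
      have "(norm (z - c))\<^sup>2 < r\<^sup>2"
        using that r by (intro power_strict_mono) (auto simp: dist_norm norm_minus_commute)
      then have "q z < 0" using r unfolding nq by (simp add: mult_less_cancel_left_pos)
      then show ?thesis by (simp add: \<eta>_def \<rho>_def)
    qed
    show "complex_of_real (\<eta> z) = 0" if "z \<notin> cball c s" for z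
    proof -
      have "(norm (z - c))\<^sup>2 > (2 * r)\<^sup>2"
        using that r by (intro power_strict_mono) (auto simp: dist_norm norm_minus_commute)
      then have "r\<^sup>2 * (1 + q z) > r\<^sup>2 * 4" unfolding nq by (simp add: power2_eq_square)
      then have "1 + q z > 4" using r by (subst (asm) mult_less_cancel_left_pos) auto
      then have "\<rho> (q z) \<ge> 1" unfolding \<rho>_def by (intro one_le_power) auto
      then show ?thesis by (simp add: \<eta>_def \<rho>_def[of "1 - _"])
    qed
    show "cball c s \<subseteq> D" by (rule s)
    then show "ball c r \<subseteq> D" using r by auto
  qed
qed

context cutoff begin

text \<open>This lives on the ring between \<open>ball c r\<close> and \<open>cball c s\<close>, so
  a Cauchy kernel with pole near \<open>c\<close> is regular wherever it is nonzero.\<close>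

definition X :: "complex \<Rightarrow> complex"
  where "X z = (\<theta>' z 1 + \<i> * \<theta>' z \<i>) / 2"

lemma L_nonneg: "L \<ge> 0"
  using bnd'[of 0 1] by (auto intro: order_trans[OF norm_ge_zero])

lemma measurable_cutoff [measurable]: "\<theta> \<in> borel_measurable borel" "X \<in> borel_measurable borel"
proof -
  show "\<theta> \<in> borel_measurable borel"
    by (intro borel_measurable_continuous_onI)
       (metis der continuous_at_imp_continuous_on has_derivative_continuous)
  have [measurable]: "(\<lambda>z. \<theta>' z h) \<in> borel_measurable borel" for h
    by (rule borel_measurable_has_derivative[OF der])
  show "X \<in> borel_measurable borel" unfolding X_def by measurable
qed

lemma X_bound: "norm (X z) \<le> L"
proof -
  have "norm (X z) \<le> (norm (\<theta>' z 1) + norm (\<i> * \<theta>' z \<i>)) / 2"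
    unfolding X_def using norm_triangle_ineq[of "\<theta>' z 1" "\<i> * \<theta>' z \<i>"] by (simp add: norm_divide)
  also have "\<dots> \<le> (L + L) / 2"
    using bnd'[of z 1] bnd'[of z \<i>] by (intro divide_right_mono add_mono) (auto simp: norm_mult)
  finally show ?thesis by simp
qed

lemma X_eq_0: "z \<in> ball c r \<Longrightarrow> X z = 0"
  unfolding X_def using has_derivative_locally_constant[OF der open_ball _ one] by simp

lemma not_in_cball: "z \<notin> D \<Longrightarrow> z \<notin> cball c s"
  using cball by blast

lemma \<theta>'_eq_0: "z \<notin> D \<Longrightarrow> \<theta>' z h = 0"
  by (rule has_derivative_locally_constant[OF der, of "- cball c s" z 0])
     (use zero not_in_cball in \<open>auto simp del: mem_cball\<close>)

lemma \<theta>_eq_0: "z \<notin> D \<Longrightarrow> \<theta> z = 0"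
  by (rule zero[OF not_in_cball])

text \<open>A coefficient extended by zero may jump at the boundary of \<open>D\<close>, but around
  points that \<open>\<pi>\<close> sends outside \<open>D\<close> the cutoff vanishes on an open
  set. The linear map \<open>\<pi>\<close> (not the number) covers both slices in one variable and
  coordinate projections.\<close>

lemma has_derivative_cutoff_mult:
  fixes \<pi> :: "'p::real_normed_vector \<Rightarrow> complex" and g :: "'p \<Rightarrow> complex"
  assumes \<pi>: "bounded_linear \<pi>"
    and g: "\<pi> p \<in> D \<Longrightarrow> (g has_derivative g') (at p)"
  shows "((\<lambda>p. \<theta> (\<pi> p) * g p) has_derivative (\<lambda>h. \<theta> (\<pi> p) * g' h + \<theta>' (\<pi> p) (\<pi> h) * g p)) (at p)"
proof (cases "\<pi> p \<in> D")
  case True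
  show ?thesis
    by (rule has_derivative_mult[OF has_derivative_compose[OF _ der] g[OF True]])
       (rule bounded_linear.has_derivative[OF \<pi> has_derivative_ident])
next
  case False
  have "open (\<pi> -` (- cball c s))"
    using \<pi> by (intro open_vimage) (auto simp: linear_continuous_on)
  then have "((\<lambda>p. \<theta> (\<pi> p) * g p) has_derivative (\<lambda>h. 0)) (at p)"
    by (intro has_derivative_transform_within_open[OF has_derivative_const[of 0], of "\<pi> -` (- cball c s)"])
       (use False not_in_cball zero in \<open>auto simp del: mem_cball\<close>)
  then show ?thesis using False by (simp add: \<theta>'_eq_0 \<theta>_eq_0)
qed

lemma norm_cutoff_mult_derivative_le:
  assumes "norm (g' h) \<le> M * norm h" "norm y \<le> M" "norm (\<pi> h) \<le> norm h"
  shows "norm (\<theta> z * g' h + \<theta>' z (\<pi> h) * y) \<le> (M + L * M) * norm h"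
proof -
  have "norm (\<theta> z * g' h + \<theta>' z (\<pi> h) * y) \<le> norm (\<theta> z) * norm (g' h) + norm (\<theta>' z (\<pi> h)) * norm y"
    by (rule order_trans[OF norm_triangle_ineq]) (simp add: norm_mult)
  also have "\<dots> \<le> 1 * (M * norm h) + (L * norm h) * M"
    using L_nonneg order_trans[OF bnd' mult_left_mono[OF assms(3) L_nonneg]]
    by (intro add_mono mult_mono bnd assms) auto
  finally show ?thesis by (simp add: algebra_simps)
qed

end

section \<open>Derivatives of Cauchy transforms\<close>

lemma norm_fst_snd_le: "norm (fst p) \<le> norm p" "norm (snd p) \<le> norm p"
  by (metis norm_fst_le prod.collapse) (metis norm_snd_le prod.collapse)

text \<open>With these rules a complex linear derivative cancels in the Wirtinger sum.\<close>

lemma imaginary_unit_mult: "\<i> * (a * \<i>) = - a" "\<i> * (a * \<i> * b) = - (a * b)"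
  by (simp_all add: complex_eq_iff)

lemma norm_mult_diff_le:
  fixes a b a0 b0 :: "'a::real_normed_algebra"
  assumes "norm (a - a0) \<le> A'" "norm b \<le> B" "norm a0 \<le> A" "norm (b - b0) \<le> B'" "A' \<ge> 0" "A \<ge> 0"
  shows "norm (a * b - a0 * b0) \<le> A' * B + A * B'"
proof -
  have "a * b - a0 * b0 = (a - a0) * b + a0 * (b - b0)" by (simp add: algebra_simps)
  also have "norm \<dots> \<le> norm (a - a0) * norm b + norm a0 * norm (b - b0)"
    by (intro order_trans[OF norm_triangle_ineq] add_mono norm_mult_ineq)
  also have "\<dots> \<le> A' * B + A * B'"
    using assms by (intro add_mono mult_mono) auto
  finally show ?thesis .
qed

text \<open>Translating the singularity to the origin moves the dependence on \<open>z\<close> from the kernel into the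
  differentiable function. At the singularity itself all integrands vanish because \<open>x / 0 = 0\<close>.\<close>

lemma cauchy_transform_has_derivative:
  fixes \<psi> :: "complex \<times> complex \<Rightarrow> complex"
  assumes e: "e > 0"
    and der: "\<And>p. snd p \<in> ball c2 e \<Longrightarrow> (\<psi> has_derivative \<psi>' p) (at p)"
    and bnd': "\<And>p h. snd p \<in> ball c2 e \<Longrightarrow> norm (\<psi>' p h) \<le> K * norm h"
    and bnd: "\<And>p. norm (\<psi> p) \<le> M"
    and supp: "\<And>p. norm (fst p) > R \<Longrightarrow> \<psi> p = 0"
  obtains G' where "((\<lambda>z. \<integral>\<zeta>. \<psi> (\<zeta>, snd z) / (\<zeta> - fst z) \<partial>lborel) has_derivative G') (at (c1, c2))"
    and "G' (1, 0) + \<i> * G' (\<i>, 0) = - 2 * pi * \<psi> (c1, c2)"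
    and "G' (0, 1) + \<i> * G' (0, \<i>) = (\<integral>\<zeta>. (\<psi>' (\<zeta>, c2) (0, 1) + \<i> * \<psi>' (\<zeta>, c2) (0, \<i>)) / (\<zeta> - c1) \<partial>lborel)"
proof -
  define F where "F z w = \<psi> (fst z + w, snd z) / w" for z w
  define F' where "F' w h = \<psi>' (c1 + w, c2) h / w" for w h
  have c2: "c2 \<in> ball c2 e" using e by simp
  have der1: "((\<lambda>\<zeta>. \<psi> (\<zeta>, t)) has_derivative (\<lambda>h. \<psi>' (\<zeta>, t) (h, 0))) (at \<zeta>)" if "t \<in> ball c2 e" for \<zeta> t
    by (rule has_derivative_compose[OF _ der]) (use that in \<open>auto intro!: derivative_eq_intros\<close>)
  have meas: "(\<lambda>\<zeta>. \<psi> (\<zeta>, t)) \<in> borel_measurable borel" if "t \<in> ball c2 e" for t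
    by (intro borel_measurable_continuous_onI)
       (metis der1[OF that] continuous_at_imp_continuous_on has_derivative_continuous)
  have mem: "snd z \<in> ball c2 e" "norm (fst z - c1) < e" if "z \<in> ball (c1, c2) e" for z
    using that norm_fst_snd_le[of "z - (c1, c2)"] by (auto simp: dist_norm norm_minus_commute)
  have int: "integrable lborel (F z)" if "snd z \<in> ball c2 e" for z
  proof -
    have m: "(\<lambda>\<zeta>. \<psi> (\<zeta>, snd z) / (\<zeta> - fst z)) \<in> borel_measurable borel"
      using meas[OF that] by measurable
    have "integrable lborel (\<lambda>\<zeta>. \<psi> (\<zeta>, snd z) / (\<zeta> - fst z))"
      by (rule integrable_cauchy_kernel[OF meas[OF that] bnd supp]) simp
    then show ?thesis
      unfolding integral_lborel_translate(2)[OF m, of "fst z", symmetric] by (simp add: F_def[abs_def])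
  qed
  have F_eq: "(\<integral>w. F z w \<partial>lborel) = (\<integral>\<zeta>. \<psi> (\<zeta>, snd z) / (\<zeta> - fst z) \<partial>lborel)" if "snd z \<in> ball c2 e" for z
  proof -
    have m: "(\<lambda>\<zeta>. \<psi> (\<zeta>, snd z) / (\<zeta> - fst z)) \<in> borel_measurable borel"
      using meas[OF that] by measurable
    show ?thesis
      using integral_lborel_translate(1)[OF m, of "fst z"] by (simp add: F_def)
  qed
  have F_der: "((\<lambda>z. F z w) has_derivative F' w) (at (c1, c2))" for w
  proof -
    have "((\<lambda>z. \<psi> (fst z + w, snd z)) has_derivative (\<lambda>h. \<psi>' (fst (c1, c2) + w, snd (c1, c2)) (fst h, snd h))) (at (c1, c2))"
      by (rule has_derivative_compose[OF _ der]) (use c2 in \<open>auto intro!: derivative_eq_intros\<close>)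
    from bounded_linear.has_derivative[OF bounded_linear_divide this] show ?thesis
      by (simp add: F_def F'_def[abs_def])
  qed
  have K: "K \<ge> 0" using bnd'[of "(c1, c2)" "(1, 0)"] c2
    by (auto simp: norm_Pair intro: order_trans[OF norm_ge_zero])
  \<comment> \<open>While \<open>fst z\<close> stays within \<open>e\<close> of \<open>c1\<close>,
    both integrands vanish once \<open>norm w\<close> exceeds \<open>R + norm c1 + e\<close>; this
    gives the radius of the dominating disc.\<close>
  have F_lip: "norm (F z w - F (c1, c2) w)
      \<le> K * (indicator (cball 0 (R + norm c1 + e)) w / norm (w - 0)) * norm (z - (c1, c2))"
    if z: "z \<in> ball (c1, c2) e" for z w
  proof (cases "norm w \<le> R + norm c1 + e")
    case True
    have "norm (\<psi> (fst z + w, snd z) - \<psi> (c1 + w, c2)) \<le> K * norm ((fst z + w, snd z) - (c1 + w, c2))"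
      by (rule bounded_derivative_imp_lipschitz[of "UNIV \<times> ball c2 e", OF _ der bnd'])
         (use mem[OF z] c2 in \<open>auto intro: convex_Times\<close>)
    also have "(fst z + w, snd z) - (c1 + w, c2) = z - (c1, c2)" by (simp add: prod_eq_iff)
    finally have "norm (\<psi> (fst z + w, snd z) - \<psi> (c1 + w, c2)) / norm w \<le> K * norm (z - (c1, c2)) / norm w"
      by (intro divide_right_mono) auto
    moreover have "F z w - F (c1, c2) w = (\<psi> (fst z + w, snd z) - \<psi> (c1 + w, c2)) / w"
      by (simp add: F_def diff_divide_distrib)
    ultimately show ?thesis using True by (simp add: norm_divide)
  next
    case False
    have "norm (c1 + w) > R" "norm (fst z + w) > R"
      using False e mem(2)[OF z] norm_diff_ineq[of w c1] norm_diff_ineq[of w "fst z"] norm_triangle_sub[of "fst z" c1]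
      by (auto simp: add.commute)
    then show ?thesis using supp K by (auto simp: F_def intro!: divide_nonneg_nonneg mult_nonneg_nonneg)
  qed
  have b: "integrable lborel (\<lambda>w::complex. K * (indicator (cball 0 (R + norm c1 + e)) w / norm (w - 0)))"
    by (intro integrable_mult_right integrable_inverse_norm_complex)
  note leib = leibniz_integral[of e "(c1, c2)" lborel F F', OF e _ F_der F_lip b]
  have I: "integrable lborel (\<lambda>w. F' w h)" for h
    by (rule leib(2)) (use int mem in auto)
  define G' where "G' h = (\<integral>w. F' w h \<partial>lborel)" for h
  have "((\<lambda>z. \<integral>w. F z w \<partial>lborel) has_derivative G') (at (c1, c2))"
    unfolding G'_def by (rule leib(1)) (use int mem in auto)
  then have G: "((\<lambda>z. \<integral>\<zeta>. \<psi> (\<zeta>, snd z) / (\<zeta> - fst z) \<partial>lborel) has_derivative G') (at (c1, c2))"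
    by (rule has_derivative_transform_within_open[of _ _ _ _ "UNIV \<times> ball c2 e"])
       (use F_eq c2 in \<open>auto intro: open_Times\<close>)
  have sum: "G' h + \<i> * G' k = (\<integral>w. (\<psi>' (c1 + w, c2) h + \<i> * \<psi>' (c1 + w, c2) k) / w \<partial>lborel)" for h k
  proof -
    have "G' h + \<i> * G' k = (\<integral>w. F' w h + \<i> * F' w k \<partial>lborel)"
      unfolding G'_def using I[of h] I[of k] by simp
    then show ?thesis by (simp add: F'_def add_divide_distrib)
  qed
  \<comment> \<open>After the translation the derivative in the first variable falls on
    \<open>\<psi>\<close>, and Cauchy-Pompeiu recovers \<open>\<psi>\<close> at the pole. The factor
    2 appears because the Wirtinger sums are not halved.\<close>
  have "G' (1, 0) + \<i> * G' (\<i>, 0) = 2 * (\<integral>w. (\<psi>' (c1 + w, c2) (1, 0) + \<i> * \<psi>' (c1 + w, c2) (\<i>, 0)) / 2 / w \<partial>lborel)"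
  proof -
    have "2 * (a / 2 / w) = a / w" for a w :: complex by simp
    then show ?thesis
      unfolding sum Bochner_Integration.integral_mult_right_zero[symmetric] by (simp only:)
  qed
  also have "(\<integral>w. (\<psi>' (c1 + w, c2) (1, 0) + \<i> * \<psi>' (c1 + w, c2) (\<i>, 0)) / 2 / w \<partial>lborel) = - pi * \<psi> (c1 + 0, c2)"
  proof (rule cauchy_pompeiu_0)
    show "((\<lambda>w. \<psi> (c1 + w, c2)) has_derivative (\<lambda>h. \<psi>' (c1 + w, c2) (h, 0))) (at w)" for w
      by (rule has_derivative_compose[OF _ der1[OF c2], where f' = "\<lambda>h. h", simplified])
         (auto intro!: derivative_eq_intros)
    show "norm (\<psi>' (c1 + w, c2) (h, 0)) \<le> K * norm h" for w h
      using bnd'[of "(c1 + w, c2)" "(h, 0)"] c2 by (simp add: norm_Pair)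
    show "\<psi> (c1 + w, c2) = 0" if "norm w > R + norm c1" for w
      by (rule supp) (use that norm_diff_ineq[of w c1] in \<open>simp add: add.commute\<close>)
  qed
  finally have 1: "G' (1, 0) + \<i> * G' (\<i>, 0) = - 2 * pi * \<psi> (c1, c2)" by simp
  have m': "(\<lambda>\<zeta>. (\<psi>' (\<zeta>, c2) (0, 1) + \<i> * \<psi>' (\<zeta>, c2) (0, \<i>)) / (\<zeta> - c1)) \<in> borel_measurable borel"
  proof -
    have [measurable]: "(\<lambda>\<zeta>. \<psi>' (\<zeta>, c2) h) \<in> borel_measurable borel" for h
    proof -
      have "(\<lambda>w. w * F' w h) \<in> borel_measurable borel"
        using borel_measurable_integrable[OF I[of h]] by simp
      \<comment> \<open>Measurability is read off from the integrable \<open>F'\<close>. Division by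
        zero erases the value at the single point \<open>c1\<close>, which is put back by
        hand.\<close>
      moreover have "(\<lambda>\<zeta>. \<psi>' (\<zeta>, c2) h) = (\<lambda>\<zeta>. if \<zeta> = c1 then \<psi>' (c1, c2) h else (\<lambda>w. w * F' w h) (\<zeta> - c1))"
        by (auto simp: F'_def fun_eq_iff)
      ultimately show ?thesis by simp
    qed
    show ?thesis by measurable
  qed
  have 2: "G' (0, 1) + \<i> * G' (0, \<i>) = (\<integral>\<zeta>. (\<psi>' (\<zeta>, c2) (0, 1) + \<i> * \<psi>' (\<zeta>, c2) (0, \<i>)) / (\<zeta> - c1) \<partial>lborel)"
    unfolding sum using integral_lborel_translate(1)[OF m', of c1] by simp
  from that[OF G 1 2] show ?thesis .
qed

text \<open>Since \<open>X\<close> vanishes near \<open>c1\<close>, only the second kernel is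
  singular, and only the second variable is translated. The first kernel depends holomorphically on
  \<open>fst z\<close>, hence no antiholomorphic derivative there; in the second variable the
  derivative falls on \<open>Q\<close> and Cauchy-Pompeiu evaluates the inner integral.\<close>

lemma double_cauchy_transform_has_derivative:
  fixes Q :: "complex \<times> complex \<Rightarrow> complex"
  assumes r: "r > 0"
    and Qm [measurable]: "Q \<in> borel_measurable borel" and Xm [measurable]: "X \<in> borel_measurable borel"
    and Q: "\<And>p. norm (Q p) \<le> M" and X: "\<And>z. norm (X z) \<le> L"
    and X0: "\<And>z. z \<in> ball c1 r \<Longrightarrow> X z = 0"
    and supp: "\<And>p. norm (fst p) > R \<or> norm (snd p) > R \<Longrightarrow> Q p = 0"
    and der: "\<And>x y. ((\<lambda>y. Q (x, y)) has_derivative Q' x y) (at y)"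
    and bnd': "\<And>x y h. norm (Q' x y h) \<le> K * norm h"
  obtains G' where "((\<lambda>z. \<integral>p. X (fst p) * Q p / ((fst p - fst z) * (snd p - snd z)) \<partial>lborel) has_derivative G') (at (c1, c2))"
    and "G' (1, 0) + \<i> * G' (\<i>, 0) = 0"
    and "G' (0, 1) + \<i> * G' (0, \<i>) = - 2 * pi * (\<integral>\<zeta>. X \<zeta> * Q (\<zeta>, c2) / (\<zeta> - c1) \<partial>lborel)"
proof -
  define U where "U x z = X x * (1 / (x - fst z))" for x :: complex and z :: "complex \<times> complex"
  define F where "F z p = U (fst p) z * Q (fst p, snd z + snd p) / snd p" for z p
  define F' where "F' p h = (U (fst p) (c1, c2) * Q' (fst p) (c2 + snd p) (snd h)
      + X (fst p) * (fst h / (fst p - c1)\<^sup>2) * Q (fst p, c2 + snd p)) / snd p" for p h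
  have L: "L \<ge> 0" and M: "M \<ge> 0" and K: "K \<ge> 0"
    using X[of 0] Q[of 0] bnd'[of 0 0 1] by (auto intro: order_trans[OF norm_ge_zero])
  have e: "r / 2 > 0" using r by simp
  have far: "norm (x - c1) \<ge> r" if "X x \<noteq> 0" for x
    using that X0[of x] by (auto simp: dist_norm norm_minus_commute not_less[symmetric])
  have mem: "norm (fst z - c1) < r / 2" "norm (snd z - c2) < r / 2" if "z \<in> ball (c1, c2) (r / 2)" for z
    using that norm_fst_snd_le[of "z - (c1, c2)"] by (auto simp: dist_norm norm_minus_commute)
  have U_bound: "norm (U x z) \<le> L * (2 / r)" if "z \<in> ball (c1, c2) (r / 2)" for x z
  proof (cases "X x = 0")
    case False
    show ?thesis unfolding U_def norm_mult
      by (intro mult_mono X inverse_cutoff_kernel(1)[OF r far[OF False] mem(1)[OF that]] L) auto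
  qed (use L r in \<open>simp add: U_def\<close>)
  have U_lip: "norm (U x z - U x (c1, c2)) \<le> L * (2 / r\<^sup>2 * norm (z - (c1, c2)))"
    if "z \<in> ball (c1, c2) (r / 2)" for x z
  proof (cases "X x = 0")
    case False
    have "norm (1 / (x - fst z) - 1 / (x - c1)) \<le> 2 / r\<^sup>2 * norm (fst z - c1)"
      by (rule inverse_cutoff_kernel(2)[OF r far[OF False] mem(1)[OF that]])
    also have "\<dots> \<le> 2 / r\<^sup>2 * norm (z - (c1, c2))"
      using norm_fst_snd_le(1)[of "z - (c1, c2)"] by (intro mult_left_mono) auto
    finally have *: "norm (1 / (x - fst z) - 1 / (x - c1)) \<le> 2 / r\<^sup>2 * norm (z - (c1, c2))" .
    have "norm (U x z - U x (c1, c2)) = norm (X x) * norm (1 / (x - fst z) - 1 / (x - c1))"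
      unfolding U_def by (simp add: norm_mult[symmetric] right_diff_distrib)
    also have "\<dots> \<le> L * (2 / r\<^sup>2 * norm (z - (c1, c2)))"
      by (intro mult_mono X * L) auto
    finally show ?thesis .
  qed (use L in \<open>simp add: U_def\<close>)
  have U_der: "(U x has_derivative (\<lambda>h. X x * (fst h / (x - c1)\<^sup>2))) (at (c1, c2))" for x
  proof (cases "X x = 0")
    case True
    then show ?thesis by (simp add: U_def[abs_def])
  next
    case False
    have "((\<lambda>z. 1 / (x - fst z)) has_derivative (\<lambda>h. fst h / (x - c1)\<^sup>2)) (at (c1, c2))"
      by (rule has_derivative_compose[of fst fst "(c1, c2)" UNIV "\<lambda>z. 1 / (x - z)"])
         (use inverse_cutoff_kernel(3)[OF r far[OF False], of c1] r in \<open>auto intro!: derivative_eq_intros\<close>)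
    then show ?thesis unfolding U_def by (rule has_derivative_mult_right)
  qed
  have F_der: "((\<lambda>z. F z p) has_derivative F' p) (at (c1, c2))" for p
  proof -
    have "((\<lambda>z. Q (fst p, snd z + snd p)) has_derivative (\<lambda>h. Q' (fst p) (snd (c1, c2) + snd p) (snd h))) (at (c1, c2))"
      by (rule has_derivative_compose[OF _ der]) (auto intro!: derivative_eq_intros)
    from bounded_linear.has_derivative[OF bounded_linear_divide has_derivative_mult[OF U_der this]]
    show ?thesis by (simp add: F_def F'_def[abs_def])
  qed
  \<comment> \<open>The two summands of a product rule: Lipschitz constant of \<open>U\<close> times
    bound of \<open>Q\<close>, plus bound of \<open>U\<close> times Lipschitz constant of
    \<open>Q\<close>.\<close>
  define C where "C = L * (2 / r\<^sup>2) * M + L * (2 / r) * K"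
  have C: "C \<ge> 0" unfolding C_def using L M K r by simp
  have F_lip: "norm (F z p - F (c1, c2) p)
      \<le> C * (indicator (cball 0 R) (fst p) * (indicator (cball 0 (R + norm c2 + r)) (snd p) / norm (snd p - 0)))
          * norm (z - (c1, c2))"
    if z: "z \<in> ball (c1, c2) (r / 2)" for z p
  proof (cases "norm (fst p) \<le> R \<and> norm (snd p) \<le> R + norm c2 + r")
    case True
    have "norm (Q (fst p, snd z + snd p) - Q (fst p, c2 + snd p)) \<le> K * norm (snd z + snd p - (c2 + snd p))"
      by (rule bounded_derivative_imp_lipschitz[of UNIV "\<lambda>y. Q (fst p, y)", OF _ der bnd']) auto
    also have "\<dots> \<le> K * norm (z - (c1, c2))"
      using norm_fst_snd_le(2)[of "z - (c1, c2)"] K by (intro mult_left_mono) auto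
    finally have "norm (Q (fst p, snd z + snd p) - Q (fst p, c2 + snd p)) \<le> K * norm (z - (c1, c2))" .
    then have "norm (U (fst p) z * Q (fst p, snd z + snd p) - U (fst p) (c1, c2) * Q (fst p, c2 + snd p))
        \<le> L * (2 / r\<^sup>2 * norm (z - (c1, c2))) * M + L * (2 / r) * (K * norm (z - (c1, c2)))"
      using L r e by (intro norm_mult_diff_le U_lip[OF z] U_bound Q) auto
    also have "\<dots> = C * norm (z - (c1, c2))" by (simp add: C_def algebra_simps)
    finally have "norm (U (fst p) z * Q (fst p, snd z + snd p) - U (fst p) (c1, c2) * Q (fst p, c2 + snd p)) / norm (snd p)
        \<le> C * norm (z - (c1, c2)) / norm (snd p)"
      by (rule divide_right_mono) simp
    moreover have "F z p - F (c1, c2) p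
        = (U (fst p) z * Q (fst p, snd z + snd p) - U (fst p) (c1, c2) * Q (fst p, c2 + snd p)) / snd p"
      by (simp add: F_def diff_divide_distrib)
    ultimately show ?thesis using True by (simp add: norm_divide)
  next
    case False
    have "Q (fst p, c2 + snd p) = 0" "Q (fst p, snd z + snd p) = 0"
      using False r mem(2)[OF z] norm_diff_ineq[of "snd p" c2] norm_diff_ineq[of "snd p" "snd z"]
        norm_triangle_sub[of "snd z" c2]
      by (auto intro!: supp simp: add.commute)
    then show ?thesis using C by (auto simp: F_def intro!: divide_nonneg_nonneg mult_nonneg_nonneg)
  qed
  have b: "integrable lborel (\<lambda>p::complex \<times> complex. C * (indicator (cball 0 R) (fst p)
      * (indicator (cball 0 (R + norm c2 + r)) (snd p) / norm (snd p - 0))))"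
    by (intro integrable_mult_right integrable_lborel_mult_prod integrable_inverse_norm_complex
        integrableI_bounded_support[where B = 1 and R = R]) (auto simp: indicator_def)
  have m: "(\<lambda>p. X (fst p) * Q p / ((fst p - x) * (snd p - y))) \<in> borel_measurable borel" for x y
    by measurable
  have F_shift: "F z p = X (fst ((0, snd z) + p)) * Q ((0, snd z) + p) / ((fst ((0, snd z) + p) - fst z) * (snd ((0, snd z) + p) - snd z))" for z p
    by (simp add: F_def U_def plus_prod_def)
  have int: "integrable lborel (F z)" for z
  proof -
    have "integrable lborel (\<lambda>p. X (fst p) * Q p / ((fst p - fst z) * (snd p - snd z)))"
      using supp by (intro integrable_double_cauchy_kernel[where B = "L * M" and R = R])
        (auto simp: norm_mult intro!: mult_mono X Q L)
    then show ?thesis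
      unfolding F_shift[abs_def] integral_lborel_translate(2)[OF m] .
  qed
  have F_eq: "(\<integral>p. F z p \<partial>lborel) = (\<integral>p. X (fst p) * Q p / ((fst p - fst z) * (snd p - snd z)) \<partial>lborel)" for z
    unfolding F_shift integral_lborel_translate(1)[OF m] ..
  note leib = leibniz_integral[of "r / 2" "(c1, c2)" lborel F F', OF e int F_der F_lip b]
  have I: "integrable lborel (\<lambda>p. F' p h)" for h
    by (rule leib(2))
  define G' where "G' h = (\<integral>p. F' p h \<partial>lborel)" for h
  have G: "((\<lambda>z. \<integral>p. X (fst p) * Q p / ((fst p - fst z) * (snd p - snd z)) \<partial>lborel) has_derivative G') (at (c1, c2))"
    using leib(1) unfolding G'_def F_eq .
  have sum: "G' h + \<i> * G' k = (\<integral>p. F' p h + \<i> * F' p k \<partial>lborel)"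
    and sumI: "integrable lborel (\<lambda>p. F' p h + \<i> * F' p k)" for h k
    unfolding G'_def using I[of h] I[of k] by simp_all
  have Q'0: "Q' x y 0 = 0" for x y
    using bnd'[of x y 0] by simp
  \<comment> \<open>For increments in the first coordinate \<open>Q'\<close> is evaluated at 0, and
    the remaining term is complex linear in \<open>fst h\<close>.\<close>
  have "F' p (1, 0) + \<i> * F' p (\<i>, 0) = 0" for p
    by (simp add: F'_def Q'0 add_divide_distrib[symmetric] imaginary_unit_mult)
  then have 1: "G' (1, 0) + \<i> * G' (\<i>, 0) = 0" unfolding sum by simp
  have F'2: "F' (x, y) (0, 1) + \<i> * F' (x, y) (0, \<i>)
      = 2 * U x (c1, c2) * ((Q' x (c2 + y) 1 + \<i> * Q' x (c2 + y) \<i>) / 2 / y)" for x y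
  proof -
    have "u * a / y + \<i> * (u * b / y) = 2 * u * ((a + \<i> * b) / 2 / y)" for u a b :: complex
      by (simp add: add_divide_distrib distrib_left)
    then show ?thesis by (simp add: F'_def)
  qed
  have inner: "(\<integral>y. (Q' x (c2 + y) 1 + \<i> * Q' x (c2 + y) \<i>) / 2 / y \<partial>lborel) = - pi * Q (x, c2 + 0)" for x
  proof (rule cauchy_pompeiu_0)
    show "((\<lambda>y. Q (x, c2 + y)) has_derivative Q' x (c2 + y)) (at y)" for y
      by (rule has_derivative_compose[OF _ der, where f' = "\<lambda>h. h", simplified])
         (auto intro!: derivative_eq_intros)
    show "Q (x, c2 + y) = 0" if "norm y > R + norm c2" for y
      by (rule supp) (use that norm_diff_ineq[of y c2] in \<open>simp add: add.commute\<close>)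
  qed (rule bnd')
  \<comment> \<open>Fubini with the second variable inside: the factor \<open>U x (c1, c2)\<close>
    leaves the inner integral, which is then the one evaluated in \<open>inner\<close>.\<close>
  have "G' (0, 1) + \<i> * G' (0, \<i>) = (\<integral>x. 2 * U x (c1, c2) * (- pi * Q (x, c2)) \<partial>lborel)"
    unfolding sum integral_lborel_prod(1)[OF sumI] F'2
    by (simp only: Bochner_Integration.integral_mult_right_zero inner add_0_right)
  also have "\<dots> = (\<integral>x. (- 2 * pi) * (X x * Q (x, c2) / (x - c1)) \<partial>lborel)"
    by (intro Bochner_Integration.integral_cong) (auto simp: U_def)
  also have "\<dots> = - 2 * pi * (\<integral>x. X x * Q (x, c2) / (x - c1) \<partial>lborel)"
    by (rule Bochner_Integration.integral_mult_right_zero)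
  finally have 2: "G' (0, 1) + \<i> * G' (0, \<i>) = - 2 * pi * (\<integral>x. X x * Q (x, c2) / (x - c1) \<partial>lborel)" .
  from that[OF G 1 2] show ?thesis .
qed

text \<open>\<open>N\<close> vanishes as soon as either coordinate is near its pole, so the
  integrand is holomorphic in \<open>z\<close> near \<open>(c1, c2)\<close>. The derivative under
  the integral is complex linear in each coordinate and cancels in both Wirtinger sums.\<close>

lemma nonsingular_double_cauchy_transform_has_derivative:
  fixes N :: "complex \<times> complex \<Rightarrow> complex"
  assumes r: "r > 0"
    and Nm [measurable]: "N \<in> borel_measurable borel"
    and N: "\<And>p. norm (N p) \<le> B"
    and supp: "\<And>p. norm (fst p) > R \<or> norm (snd p) > R \<Longrightarrow> N p = 0"
    and N0: "\<And>p. fst p \<in> ball c1 r \<or> snd p \<in> ball c2 r \<Longrightarrow> N p = 0"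
  obtains G' where "((\<lambda>z. \<integral>p. N p / ((fst p - fst z) * (snd p - snd z)) \<partial>lborel) has_derivative G') (at (c1, c2))"
    and "G' (1, 0) + \<i> * G' (\<i>, 0) = 0"
    and "G' (0, 1) + \<i> * G' (0, \<i>) = 0"
proof -
  define F where "F z p = N p * ((1 / (fst p - fst z)) * (1 / (snd p - snd z)))" for z p
  define F' where "F' p h = N p * ((1 / (fst p - c1)) * (snd h / (snd p - c2)\<^sup>2) + (fst h / (fst p - c1)\<^sup>2) * (1 / (snd p - c2)))" for p h
  have B: "B \<ge> 0" using N[of 0] by (auto intro: order_trans[OF norm_ge_zero])
  have e: "r / 2 > 0" using r by simp
  have far: "norm (fst p - c1) \<ge> r" "norm (snd p - c2) \<ge> r" if "N p \<noteq> 0" for p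
    using that N0[of p] by (auto simp: dist_norm norm_minus_commute not_less[symmetric])
  have mem: "norm (fst z - c1) < r / 2" "norm (snd z - c2) < r / 2" if "z \<in> ball (c1, c2) (r / 2)" for z
    using that norm_fst_snd_le[of "z - (c1, c2)"] by (auto simp: dist_norm norm_minus_commute)
  have F_der: "((\<lambda>z. F z p) has_derivative F' p) (at (c1, c2))" for p
  proof (cases "N p = 0")
    case True
    then show ?thesis by (simp add: F_def F'_def[abs_def])
  next
    case False
    have 1: "((\<lambda>z. 1 / (fst p - fst z)) has_derivative (\<lambda>h. fst h / (fst p - c1)\<^sup>2)) (at (c1, c2))"
      by (rule has_derivative_compose[of fst fst "(c1, c2)" UNIV "\<lambda>z. 1 / (fst p - z)"])
         (use inverse_cutoff_kernel(3)[OF r far(1)[OF False], of c1] r in \<open>auto intro!: derivative_eq_intros\<close>)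
    have 2: "((\<lambda>z. 1 / (snd p - snd z)) has_derivative (\<lambda>h. snd h / (snd p - c2)\<^sup>2)) (at (c1, c2))"
      by (rule has_derivative_compose[of snd snd "(c1, c2)" UNIV "\<lambda>z. 1 / (snd p - z)"])
         (use inverse_cutoff_kernel(3)[OF r far(2)[OF False], of c2] r in \<open>auto intro!: derivative_eq_intros\<close>)
    show ?thesis
      using has_derivative_mult_right[OF has_derivative_mult[OF 1 2], of "N p"]
      by (simp add: F_def F'_def[abs_def])
  qed
  \<comment> \<open>Two product-rule terms, each a Lipschitz constant \<open>2 / r\<^sup>2\<close>
    of one kernel times the bound \<open>2 / r\<close> of the other.\<close>
  define C where "C = B * (2 * ((2 / r\<^sup>2) * (2 / r)))"
  have F_lip: "norm (F z p - F (c1, c2) p) \<le> C * (indicator (cball 0 R) (fst p) * indicator (cball 0 R) (snd p)) * norm (z - (c1, c2))"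
    if z: "z \<in> ball (c1, c2) (r / 2)" for z p
  proof (cases "N p = 0")
    case True
    then show ?thesis using B r by (simp add: F_def C_def)
  next
    case False
    let ?n = "norm (z - (c1, c2))"
    have c: "norm (c1 - c1) < r / 2" "norm (c2 - c2) < r / 2" using e by auto
    have "norm (1 / (fst p - fst z) - 1 / (fst p - c1)) \<le> 2 / r\<^sup>2 * ?n"
      by (rule order_trans[OF inverse_cutoff_kernel(2)[OF r far(1)[OF False] mem(1)[OF z]]])
         (use norm_fst_snd_le(1)[of "z - (c1, c2)"] in \<open>auto intro!: mult_left_mono divide_right_mono\<close>)
    moreover have "norm (1 / (snd p - snd z) - 1 / (snd p - c2)) \<le> 2 / r\<^sup>2 * ?n"
      by (rule order_trans[OF inverse_cutoff_kernel(2)[OF r far(2)[OF False] mem(2)[OF z]]])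
         (use norm_fst_snd_le(2)[of "z - (c1, c2)"] in \<open>auto intro!: mult_left_mono divide_right_mono\<close>)
    ultimately have "norm ((1 / (fst p - fst z)) * (1 / (snd p - snd z)) - (1 / (fst p - c1)) * (1 / (snd p - c2)))
        \<le> (2 / r\<^sup>2 * ?n) * (2 / r) + (2 / r) * (2 / r\<^sup>2 * ?n)"
      using r by (intro norm_mult_diff_le inverse_cutoff_kernel(1)[OF r far(2)[OF False] mem(2)[OF z]]
        inverse_cutoff_kernel(1)[OF r far(1)[OF False] c(1)]) auto
    then have "norm (N p) * norm ((1 / (fst p - fst z)) * (1 / (snd p - snd z)) - (1 / (fst p - c1)) * (1 / (snd p - c2)))
        \<le> B * ((2 / r\<^sup>2 * ?n) * (2 / r) + (2 / r) * (2 / r\<^sup>2 * ?n))"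
      by (intro mult_mono N B) auto
    also have "\<dots> = C * ?n" by (simp add: C_def ac_simps)
    finally have "norm (F z p - F (c1, c2) p) \<le> C * ?n"
      unfolding F_def by (simp only: norm_mult[symmetric] right_diff_distrib fst_conv snd_conv)
    moreover have "norm (fst p) \<le> R" "norm (snd p) \<le> R"
      using supp[of p] False by (auto simp: not_less[symmetric])
    ultimately show ?thesis by simp
  qed
  have b: "integrable lborel (\<lambda>p::complex \<times> complex. C * (indicator (cball 0 R) (fst p) * indicator (cball 0 R) (snd p)))"
    by (intro integrable_mult_right integrable_lborel_mult_prod
        integrableI_bounded_support[where B = 1 and R = R]) (auto simp: indicator_def)
  have F_eq: "F z = (\<lambda>p. N p / ((fst p - fst z) * (snd p - snd z)))" for z
    by (simp add: F_def fun_eq_iff)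
  have int: "integrable lborel (F z)" for z
    unfolding F_eq by (rule integrable_double_cauchy_kernel[OF Nm N supp])
  note leib = leibniz_integral[of "r / 2" "(c1, c2)" lborel F F', OF e int F_der F_lip b]
  have I: "integrable lborel (\<lambda>p. F' p h)" for h by (rule leib(2))
  define G' where "G' h = (\<integral>p. F' p h \<partial>lborel)" for h
  have sum: "G' h + \<i> * G' k = (\<integral>p. F' p h + \<i> * F' p k \<partial>lborel)" for h k
    unfolding G'_def using I[of h] I[of k] by simp
  have "F' p (1, 0) + \<i> * F' p (\<i>, 0) = 0" "F' p (0, 1) + \<i> * F' p (0, \<i>) = 0" for p
    by (simp_all add: F'_def imaginary_unit_mult)
  then have 1: "G' (1, 0) + \<i> * G' (\<i>, 0) = 0" "G' (0, 1) + \<i> * G' (0, \<i>) = 0"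
    unfolding sum by simp_all
  have G: "((\<lambda>z. \<integral>p. N p / ((fst p - fst z) * (snd p - snd z)) \<partial>lborel) has_derivative G') (at (c1, c2))"
    using leib(1) unfolding G'_def F_eq .
  from that[OF G 1] show ?thesis .
qed

section \<open>The solution operator\<close>

text \<open>This passes from the operators defined by partial derivatives to values of the total
  derivative, in terms of which the transforms are computed.\<close>

lemma dbar_has_derivative:
  assumes "(u has_derivative u') (at z)"
  shows "dbar1 u z = (u' (1, 0) + \<i> * u' (\<i>, 0)) / 2"
    and "dbar2 u z = (u' (0, 1) + \<i> * u' (0, \<i>)) / 2"
proof -
  interpret u': bounded_linear u' using assms by (rule has_derivative_bounded_linear)
  have *: "vector_derivative (\<lambda>t. u (z + t *\<^sub>R v)) (at 0) = u' v" for v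
  proof (rule vector_derivative_at)
    have "((\<lambda>t. u (z + t *\<^sub>R v)) has_derivative (\<lambda>t. u' (t *\<^sub>R v))) (at 0)"
      by (rule has_derivative_compose[of "\<lambda>t. z + t *\<^sub>R v" "\<lambda>t. t *\<^sub>R v"])
         (use assms in \<open>auto intro!: derivative_eq_intros\<close>)
    then show "((\<lambda>t. u (z + t *\<^sub>R v)) has_vector_derivative u' v) (at 0)"
      by (simp add: has_vector_derivative_def u'.scaleR)
  qed
  show "dbar1 u z = (u' (1, 0) + \<i> * u' (\<i>, 0)) / 2"
    using *[of "(1, 0)"] *[of "(\<i>, 0)"]
    by (simp add: dbar1_def wirtinger_bar_def plus_prod_def scaleR_conv_of_real mult.commute)
  show "dbar2 u z = (u' (0, 1) + \<i> * u' (0, \<i>)) / 2"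
    using *[of "(0, 1)"] *[of "(0, \<i>)"]
    by (simp add: dbar2_def wirtinger_bar_def plus_prod_def scaleR_conv_of_real mult.commute)
qed

lemma borel_measurable_Pair_const [measurable]:
  "(\<lambda>x::'a::topological_space. (x, y::'b::topological_space)) \<in> borel_measurable borel"
  "(\<lambda>y. (x, y)) \<in> borel_measurable borel"
  by (intro borel_measurable_continuous_onI continuous_intros)+

lemma norm_mult_mono:
  fixes x y :: "'a::real_normed_algebra"
  assumes "norm x \<le> A" "norm y \<le> B"
  shows "norm (x * y) \<le> A * B"
  by (rule order_trans[OF norm_mult_ineq mult_mono]) (use assms in \<open>auto intro: order_trans[OF norm_ge_zero]\<close>)

text \<open>\<open>a\<close>, \<open>b\<close>, \<open>d\<close> model the two coefficients and
  their common mixed derivative, extended by zero so that all integrals run over the whole space.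
  The derivative data \<open>a'\<close>, \<open>b'\<close> are extended by zero as well, which makes
  the equations \<open>dbar\<close> hold everywhere although \<open>a\<close> and \<open>b\<close>
  are differentiable only inside the product.\<close>

locale closed_form =
  fixes D1 D2 :: "complex set" and a b d :: "complex \<times> complex \<Rightarrow> complex"
    and a' b' :: "complex \<times> complex \<Rightarrow> complex \<times> complex \<Rightarrow> complex" and M R :: real
  assumes open_D: "open D1" "open D2"
    and bounded_D: "\<And>z. z \<in> D1 \<Longrightarrow> norm z \<le> R" "\<And>z. z \<in> D2 \<Longrightarrow> norm z \<le> R"
    and meas [measurable]: "a \<in> borel_measurable borel" "b \<in> borel_measurable borel" "d \<in> borel_measurable borel"
    and off: "\<And>p. p \<notin> D1 \<times> D2 \<Longrightarrow> a p = 0" "\<And>p. p \<notin> D1 \<times> D2 \<Longrightarrow> b p = 0" "\<And>p. p \<notin> D1 \<times> D2 \<Longrightarrow> d p = 0"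
    and off': "\<And>p h. p \<notin> D1 \<times> D2 \<Longrightarrow> a' p h = 0" "\<And>p h. p \<notin> D1 \<times> D2 \<Longrightarrow> b' p h = 0"
    and bnd: "\<And>p. norm (a p) \<le> M" "\<And>p. norm (b p) \<le> M" "\<And>p. norm (d p) \<le> M"
    and bnd': "\<And>p h. norm (a' p h) \<le> M * norm h" "\<And>p h. norm (b' p h) \<le> M * norm h"
    and der: "\<And>p. p \<in> D1 \<times> D2 \<Longrightarrow> (a has_derivative a' p) (at p)"
      "\<And>p. p \<in> D1 \<times> D2 \<Longrightarrow> (b has_derivative b' p) (at p)"
    and dbar: "\<And>p. a' p (0, 1) + \<i> * a' p (0, \<i>) = 2 * d p"
      "\<And>p. b' p (1, 0) + \<i> * b' p (\<i>, 0) = 2 * d p"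
begin

text \<open>The constants combine those of \<open>T_op\<close> with the factors
  \<open>2 * \<i>\<close> and \<open>(2 * \<i>)\<^sup>2\<close> of the form integrals.\<close>

definition T :: "complex \<times> complex \<Rightarrow> complex"
  where "T z = - (1 / pi) * (\<integral>\<zeta>. b (fst z, \<zeta>) / (\<zeta> - snd z) \<partial>lborel)
    - (1 / pi) * (\<integral>\<zeta>. a (\<zeta>, snd z) / (\<zeta> - fst z) \<partial>lborel)
    - (1 / pi\<^sup>2) * (\<integral>p. d p / ((fst p - fst z) * (snd p - snd z)) \<partial>lborel)"

lemma outside: "norm (fst p) > R \<or> norm (snd p) > R \<Longrightarrow> p \<notin> D1 \<times> D2"
  using bounded_D by (force simp: not_le[symmetric])

lemma slice_has_derivative:
  "y \<in> D2 \<Longrightarrow> ((\<lambda>y. a (x, y)) has_derivative (\<lambda>h. a' (x, y) (0, h))) (at y)"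
  "y \<in> D2 \<Longrightarrow> ((\<lambda>y. b (x, y)) has_derivative (\<lambda>h. b' (x, y) (0, h))) (at y)"
  "x \<in> D1 \<Longrightarrow> ((\<lambda>x. b (x, y)) has_derivative (\<lambda>h. b' (x, y) (h, 0))) (at x)"
proof -
  show "((\<lambda>y. a (x, y)) has_derivative (\<lambda>h. a' (x, y) (0, h))) (at y)" if "y \<in> D2"
  proof (cases "x \<in> D1")
    case True
    show ?thesis
      by (rule has_derivative_compose[OF _ der(1)]) (use True that in \<open>auto intro!: derivative_eq_intros\<close>)
  qed (simp add: off off')
  show "((\<lambda>y. b (x, y)) has_derivative (\<lambda>h. b' (x, y) (0, h))) (at y)" if "y \<in> D2"
  proof (cases "x \<in> D1")
    case True
    show ?thesis
      by (rule has_derivative_compose[OF _ der(2)]) (use True that in \<open>auto intro!: derivative_eq_intros\<close>)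
  qed (simp add: off off')
  show "((\<lambda>x. b (x, y)) has_derivative (\<lambda>h. b' (x, y) (h, 0))) (at x)" if "x \<in> D1"
  proof (cases "y \<in> D2")
    case True
    show ?thesis
      by (rule has_derivative_compose[OF _ der(2)]) (use True that in \<open>auto intro!: derivative_eq_intros\<close>)
  qed (simp add: off off')
qed

section \<open>Local decomposition and derivative of the solution operator\<close>

lemma T_has_derivative:
  assumes c: "c1 \<in> D1" "c2 \<in> D2"
  obtains T' where "(T has_derivative T') (at (c1, c2))"
    and "T' (1, 0) + \<i> * T' (\<i>, 0) = 2 * a (c1, c2)"
    and "T' (0, 1) + \<i> * T' (0, \<i>) = 2 * b (c1, c2)"
proof -
  obtain \<theta>1 \<theta>1' r1 s1 L1 where "cutoff D1 c1 \<theta>1 \<theta>1' r1 s1 L1"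
    using cutoff_exists[OF open_D(1) c(1)] .
  then interpret C1: cutoff D1 c1 \<theta>1 \<theta>1' r1 s1 L1 .
  obtain \<theta>2 \<theta>2' r2 s2 L2 where "cutoff D2 c2 \<theta>2 \<theta>2' r2 s2 L2"
    using cutoff_exists[OF open_D(2) c(2)] .
  then interpret C2: cutoff D2 c2 \<theta>2 \<theta>2' r2 s2 L2 .

  \<comment> \<open>Cauchy-Pompeiu for \<open>\<theta>1 w * b (w, y)\<close> in the first variable,
    at points where the cutoff is 1; the product rule and \<open>dbar\<close> give the density.
    \<open>E2\<close> is the mirror image for \<open>a\<close> in the second variable.\<close>
  have E1: "(\<integral>w. (\<theta>1 w * d (w, y) + C1.X w * b (w, y)) / (w - z1) \<partial>lborel) = - pi * b (z1, y)"
    if z1: "z1 \<in> ball c1 r1" for z1 y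
  proof -
    let ?\<phi>' = "\<lambda>w h. \<theta>1 w * b' (w, y) (h, 0) + \<theta>1' w h * b (w, y)"
    have "(\<integral>w. (?\<phi>' w 1 + \<i> * ?\<phi>' w \<i>) / 2 / (w - z1) \<partial>lborel) = - pi * (\<theta>1 z1 * b (z1, y))"
    proof (rule cauchy_pompeiu)
      show "((\<lambda>w. \<theta>1 w * b (w, y)) has_derivative ?\<phi>' w) (at w)" for w
        using C1.has_derivative_cutoff_mult[OF bounded_linear_ident slice_has_derivative(3)] by simp
      show "norm (?\<phi>' w h) \<le> (M + L1 * M) * norm h" for w h
        by (rule C1.norm_cutoff_mult_derivative_le[where \<pi> = "\<lambda>x. x" and g' = "\<lambda>h. b' (w, y) (h, 0)"])
           (use bnd'(2)[of "(w, y)" "(h, 0)"] bnd in \<open>auto simp: norm_Pair\<close>)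
      show "\<theta>1 w * b (w, y) = 0" if "norm w > R" for w
        using off(2)[OF outside, of "(w, y)"] that by simp
    qed
    moreover have "(?\<phi>' w 1 + \<i> * ?\<phi>' w \<i>) / 2 = \<theta>1 w * d (w, y) + C1.X w * b (w, y)" for w
    proof -
      have "?\<phi>' w 1 + \<i> * ?\<phi>' w \<i> = \<theta>1 w * (b' (w, y) (1, 0) + \<i> * b' (w, y) (\<i>, 0))
          + (\<theta>1' w 1 + \<i> * \<theta>1' w \<i>) * b (w, y)"
        by (simp add: algebra_simps)
      then show ?thesis unfolding dbar by (simp add: C1.X_def)
    qed
    ultimately show ?thesis using C1.one[OF z1] by simp
  qed
  have E2: "(\<integral>w. (\<theta>2 w * d (x, w) + C2.X w * a (x, w)) / (w - z2) \<partial>lborel) = - pi * a (x, z2)"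
    if z2: "z2 \<in> ball c2 r2" for z2 x
  proof -
    let ?\<phi>' = "\<lambda>w h. \<theta>2 w * a' (x, w) (0, h) + \<theta>2' w h * a (x, w)"
    have "(\<integral>w. (?\<phi>' w 1 + \<i> * ?\<phi>' w \<i>) / 2 / (w - z2) \<partial>lborel) = - pi * (\<theta>2 z2 * a (x, z2))"
    proof (rule cauchy_pompeiu)
      show "((\<lambda>w. \<theta>2 w * a (x, w)) has_derivative ?\<phi>' w) (at w)" for w
        using C2.has_derivative_cutoff_mult[OF bounded_linear_ident slice_has_derivative(1)] by simp
      show "norm (?\<phi>' w h) \<le> (M + L2 * M) * norm h" for w h
        by (rule C2.norm_cutoff_mult_derivative_le[where \<pi> = "\<lambda>x. x" and g' = "\<lambda>h. a' (x, w) (0, h)"])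
           (use bnd'(1)[of "(x, w)" "(0, h)"] bnd in \<open>auto simp: norm_Pair\<close>)
      show "\<theta>2 w * a (x, w) = 0" if "norm w > R" for w
        using off(1)[OF outside, of "(x, w)"] that by simp
    qed
    moreover have "(?\<phi>' w 1 + \<i> * ?\<phi>' w \<i>) / 2 = \<theta>2 w * d (x, w) + C2.X w * a (x, w)" for w
    proof -
      have "?\<phi>' w 1 + \<i> * ?\<phi>' w \<i> = \<theta>2 w * (a' (x, w) (0, 1) + \<i> * a' (x, w) (0, \<i>))
          + (\<theta>2' w 1 + \<i> * \<theta>2' w \<i>) * a (x, w)"
        by (simp add: algebra_simps)
      then show ?thesis unfolding dbar by (simp add: C2.X_def)
    qed
    ultimately show ?thesis using C2.one[OF z2] by simp
  qed

  \<comment> \<open>The cutoff handles the boundary of \<open>D1\<close>; the second coordinate is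
    kept in \<open>ball c2 r2\<close>, inside \<open>D2\<close>, so that \<open>\<psi>\<close> is
    differentiable there in both variables jointly.\<close>
  define \<psi> where "\<psi> p = \<theta>1 (fst p) * a p" for p
  define \<psi>' where "\<psi>' p h = \<theta>1 (fst p) * a' p h + \<theta>1' (fst p) (fst h) * a p" for p h
  obtain G2 where G2: "((\<lambda>z. \<integral>\<zeta>. \<psi> (\<zeta>, snd z) / (\<zeta> - fst z) \<partial>lborel) has_derivative G2) (at (c1, c2))"
      "G2 (1, 0) + \<i> * G2 (\<i>, 0) = - 2 * pi * \<psi> (c1, c2)"
      "G2 (0, 1) + \<i> * G2 (0, \<i>) = (\<integral>\<zeta>. (\<psi>' (\<zeta>, c2) (0, 1) + \<i> * \<psi>' (\<zeta>, c2) (0, \<i>)) / (\<zeta> - c1) \<partial>lborel)"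
  proof (rule cauchy_transform_has_derivative[OF C2.r])
    show "(\<psi> has_derivative \<psi>' p) (at p)" if "snd p \<in> ball c2 r2" for p
      unfolding \<psi>_def \<psi>'_def
      by (rule C1.has_derivative_cutoff_mult[OF bounded_linear_fst der(1)])
         (use that C2.ball in \<open>auto simp: mem_Times_iff\<close>)
    show "norm (\<psi>' p h) \<le> (M + L1 * M) * norm h" for p h
      unfolding \<psi>'_def by (intro C1.norm_cutoff_mult_derivative_le bnd bnd' norm_fst_snd_le)
    show "norm (\<psi> p) \<le> 1 * M" for p
      unfolding \<psi>_def by (intro norm_mult_mono C1.bnd bnd)
    show "\<psi> p = 0" if "norm (fst p) > R" for p
      unfolding \<psi>_def using off(1)[OF outside] that by simp
  qed
  \<comment> \<open>The cutoff makes \<open>Q\<close> differentiable along the second variable, the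
    one in which the double transform differentiates it.\<close>
  define Q where "Q p = \<theta>2 (snd p) * b p" for p
  have Q_meas [measurable]: "Q \<in> borel_measurable borel" unfolding Q_def by measurable
  obtain G1 where G1: "((\<lambda>z. \<integral>p. C1.X (fst p) * Q p / ((fst p - fst z) * (snd p - snd z)) \<partial>lborel) has_derivative G1) (at (c1, c2))"
      "G1 (1, 0) + \<i> * G1 (\<i>, 0) = 0"
      "G1 (0, 1) + \<i> * G1 (0, \<i>) = - 2 * pi * (\<integral>\<zeta>. C1.X \<zeta> * Q (\<zeta>, c2) / (\<zeta> - c1) \<partial>lborel)"
  proof (rule double_cauchy_transform_has_derivative[OF C1.r Q_meas C1.measurable_cutoff(2)])
    show "norm (Q p) \<le> 1 * M" for p
      unfolding Q_def by (intro norm_mult_mono C2.bnd bnd)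
    show "norm (C1.X z) \<le> L1" for z by (rule C1.X_bound)
    show "C1.X z = 0" if "z \<in> ball c1 r1" for z using that by (rule C1.X_eq_0)
    show "Q p = 0" if "norm (fst p) > R \<or> norm (snd p) > R" for p
      unfolding Q_def using off(2)[OF outside[OF that]] by simp
    show "((\<lambda>y. Q (x, y)) has_derivative (\<lambda>h. \<theta>2 y * b' (x, y) (0, h) + \<theta>2' y h * b (x, y))) (at y)" for x y
      using C2.has_derivative_cutoff_mult[OF bounded_linear_ident slice_has_derivative(2)] by (simp add: Q_def)
    show "norm (\<theta>2 y * b' (x, y) (0, h) + \<theta>2' y h * b (x, y)) \<le> (M + L2 * M) * norm h" for x y h
      by (rule C2.norm_cutoff_mult_derivative_le[where \<pi> = "\<lambda>x. x" and g' = "\<lambda>h. b' (x, y) (0, h)"])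
         (use bnd'(2)[of "(x, y)" "(0, h)"] bnd in \<open>auto simp: norm_Pair\<close>)
  qed
  have \<theta>c: "norm (1 - \<theta>1 z) \<le> 1 + 1" "norm (1 - \<theta>2 z) \<le> 1 + 1" for z
    by (intro norm_triangle_le_diff add_mono C1.bnd C2.bnd; simp)+
  \<comment> \<open>In every summand some factor vanishes near \<open>fst p = c1\<close>
    (\<open>1 - \<theta>1\<close> or \<open>C1.X\<close>) and some factor near
    \<open>snd p = c2\<close> (\<open>1 - \<theta>2\<close> or \<open>C2.X\<close>).\<close>
  define N where "N p = (1 - \<theta>2 (snd p)) * b p * C1.X (fst p) + (1 - \<theta>1 (fst p)) * a p * C2.X (snd p)
      - (1 - \<theta>1 (fst p)) * (1 - \<theta>2 (snd p)) * d p" for p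
  have N_meas [measurable]: "N \<in> borel_measurable borel" unfolding N_def by measurable
  have N_bound: "norm (N p) \<le> ((1 + 1) * M * L1 + (1 + 1) * M * L2) + (1 + 1) * (1 + 1) * M" for p
    unfolding N_def
    by (intro norm_triangle_le_diff add_mono order_trans[OF norm_triangle_ineq] norm_mult_mono \<theta>c bnd C1.X_bound C2.X_bound)
  have N_supp: "N p = 0" if "norm (fst p) > R \<or> norm (snd p) > R" for p
    unfolding N_def using off[OF outside[OF that]] by simp
  obtain G3 where G3: "((\<lambda>z. \<integral>p. N p / ((fst p - fst z) * (snd p - snd z)) \<partial>lborel) has_derivative G3) (at (c1, c2))"
      "G3 (1, 0) + \<i> * G3 (\<i>, 0) = 0" "G3 (0, 1) + \<i> * G3 (0, \<i>) = 0"
  proof (rule nonsingular_double_cauchy_transform_has_derivative[OF _ N_meas N_bound N_supp])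
    show "min r1 r2 > 0" using C1.r C2.r by simp
    show "N p = 0" if "fst p \<in> ball c1 (min r1 r2) \<or> snd p \<in> ball c2 (min r1 r2)" for p
      using that
    proof
      assume "fst p \<in> ball c1 (min r1 r2)"
      then have "fst p \<in> ball c1 r1" by simp
      then show ?thesis unfolding N_def using C1.one C1.X_eq_0 by simp
    next
      assume "snd p \<in> ball c2 (min r1 r2)"
      then have "snd p \<in> ball c2 r2" by simp
      then show ?thesis unfolding N_def using C2.one C2.X_eq_0 by simp
    qed
  qed

  define J where "J g z = (\<integral>p. g p / ((fst p - fst z) * (snd p - snd z)) \<partial>lborel)"
    for g :: "complex \<times> complex \<Rightarrow> complex" and z :: "complex \<times> complex"
  define A where "A z = (\<integral>\<zeta>. \<psi> (\<zeta>, snd z) / (\<zeta> - fst z) \<partial>lborel)" for z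
  let ?I = "\<lambda>p. C1.X (fst p) * Q p"
  \<comment> \<open>\<open>N1\<close> and \<open>N2\<close> are chosen so that one integration, by
    \<open>E1\<close> or \<open>E2\<close>, leaves \<open>- pi\<close> times \<open>b\<close> or
    \<open>- pi\<close> times \<open>(1 - \<theta>1) * a\<close> under the other kernel.\<close>
  define N1 where "N1 p = \<theta>1 (fst p) * d p + C1.X (fst p) * b p" for p
  define N2 where "N2 p = (1 - \<theta>1 (fst p)) * (\<theta>2 (snd p) * d p + C2.X (snd p) * a p)" for p
  have iN1: "integrable lborel (\<lambda>p. N1 p / ((fst p - x) * (snd p - y)))" for x y
  proof (rule integrable_double_cauchy_kernel)
    show "N1 \<in> borel_measurable borel" unfolding N1_def by measurable
    show "norm (N1 p) \<le> 1 * M + L1 * M" for p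
      unfolding N1_def
      by (intro order_trans[OF norm_triangle_ineq] add_mono norm_mult_mono bnd C1.bnd C1.X_bound)
    show "N1 p = 0" if "norm (fst p) > R \<or> norm (snd p) > R" for p
      unfolding N1_def using off[OF outside[OF that]] by simp
  qed
  have iN2: "integrable lborel (\<lambda>p. N2 p / ((fst p - x) * (snd p - y)))" for x y
  proof (rule integrable_double_cauchy_kernel)
    show "N2 \<in> borel_measurable borel" unfolding N2_def by measurable
    show "norm (N2 p) \<le> (1 + 1) * (1 * M + L2 * M)" for p
      unfolding N2_def
      by (intro norm_mult_mono order_trans[OF norm_triangle_ineq] add_mono \<theta>c bnd C2.bnd C2.X_bound)
    show "N2 p = 0" if "norm (fst p) > R \<or> norm (snd p) > R" for p
      unfolding N2_def using off[OF outside[OF that]] by simp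
  qed
  have id: "integrable lborel (\<lambda>p. d p / ((fst p - x) * (snd p - y)))" for x y
    by (rule integrable_double_cauchy_kernel[OF meas(3) bnd(3) off(3)[OF outside]])
  have iI: "integrable lborel (\<lambda>p. ?I p / ((fst p - x) * (snd p - y)))" for x y
  proof (rule integrable_double_cauchy_kernel)
    show "norm (C1.X (fst p) * Q p) \<le> L1 * (1 * M)" for p
      unfolding Q_def by (intro norm_mult_mono bnd C2.bnd C1.X_bound)
    show "C1.X (fst p) * Q p = 0" if "norm (fst p) > R \<or> norm (snd p) > R" for p
      unfolding Q_def using off[OF outside[OF that]] by simp
  qed measurable
  have iN: "integrable lborel (\<lambda>p. N p / ((fst p - x) * (snd p - y)))" for x y
    by (rule integrable_double_cauchy_kernel[OF N_meas N_bound N_supp])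
  have i1: "integrable lborel (\<lambda>w. g w / (w - z))"
    if "g \<in> borel_measurable borel" "\<And>w. norm (g w) \<le> B" "\<And>w. norm w > R \<Longrightarrow> g w = 0"
    for g :: "complex \<Rightarrow> complex" and z B
    using integrable_cauchy_kernel that by blast

  \<comment> \<open>The regrouping is local: it uses \<open>E1\<close> and \<open>E2\<close> at the
    coordinates of \<open>z\<close>, where both cutoffs must equal 1.\<close>
  have decomp: "T z = - (1 / pi) * A z + (1 / pi\<^sup>2) * (J ?I z + J N z)"
    if z: "z \<in> ball c1 r1 \<times> ball c2 r2" for z
  proof -
    have z1: "fst z \<in> ball c1 r1" and z2: "snd z \<in> ball c2 r2" using z by (auto simp: mem_Times_iff)
    have b_eq: "- pi * (\<integral>\<zeta>. b (fst z, \<zeta>) / (\<zeta> - snd z) \<partial>lborel) = J N1 z"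
    proof -
      have "J N1 z = (\<integral>y. \<integral>x. (\<theta>1 x * d (x, y) + C1.X x * b (x, y)) / (x - fst z) / (y - snd z) \<partial>lborel \<partial>lborel)"
        unfolding J_def by (subst integral_lborel_prod(2)[OF iN1]) (simp add: N1_def)
      also have "\<dots> = (\<integral>y. - pi * (b (fst z, y) / (y - snd z)) \<partial>lborel)"
        by (simp only: Bochner_Integration.integral_divide_zero E1[OF z1] times_divide_eq_right)
      finally show ?thesis by (simp only: Bochner_Integration.integral_mult_right_zero)
    qed
    \<comment> \<open>Only the part of \<open>a\<close> away from \<open>c1\<close> is turned into a
      double integral; the near part stays in \<open>A\<close>, where it can be differentiated after
      translation.\<close>
    have a_split: "(\<integral>\<zeta>. a (\<zeta>, snd z) / (\<zeta> - fst z) \<partial>lborel)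
        = A z + (\<integral>\<zeta>. ((1 - \<theta>1 \<zeta>) * a (\<zeta>, snd z)) / (\<zeta> - fst z) \<partial>lborel)"
    proof -
      have "integrable lborel (\<lambda>\<zeta>. \<psi> (\<zeta>, snd z) / (\<zeta> - fst z))"
      proof (rule i1)
        show "(\<lambda>\<zeta>. \<psi> (\<zeta>, snd z)) \<in> borel_measurable borel" unfolding \<psi>_def by measurable
        show "norm (\<psi> (w, snd z)) \<le> 1 * M" for w
          unfolding \<psi>_def by (intro norm_mult_mono bnd C1.bnd)
        show "\<psi> (w, snd z) = 0" if "norm w > R" for w
          unfolding \<psi>_def using off(1)[OF outside, of "(w, snd z)"] that by simp
      qed
      moreover have "integrable lborel (\<lambda>\<zeta>. ((1 - \<theta>1 \<zeta>) * a (\<zeta>, snd z)) / (\<zeta> - fst z))"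
      proof (rule i1)
        show "(\<lambda>\<zeta>. (1 - \<theta>1 \<zeta>) * a (\<zeta>, snd z)) \<in> borel_measurable borel" by measurable
        show "norm ((1 - \<theta>1 w) * a (w, snd z)) \<le> (1 + 1) * M" for w
          by (intro norm_mult_mono bnd \<theta>c)
        show "(1 - \<theta>1 w) * a (w, snd z) = 0" if "norm w > R" for w
          using off(1)[OF outside, of "(w, snd z)"] that by simp
      qed
      ultimately show ?thesis
        unfolding A_def
        by (subst Bochner_Integration.integral_add[symmetric])
           (auto intro!: Bochner_Integration.integral_cong simp: \<psi>_def algebra_simps add_divide_distrib[symmetric])
    qed
    have a_eq: "- pi * (\<integral>\<zeta>. ((1 - \<theta>1 \<zeta>) * a (\<zeta>, snd z)) / (\<zeta> - fst z) \<partial>lborel) = J N2 z"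
    proof -
      have "J N2 z = (\<integral>x. \<integral>y. ((1 - \<theta>1 x) / (x - fst z)) * ((\<theta>2 y * d (x, y) + C2.X y * a (x, y)) / (y - snd z)) \<partial>lborel \<partial>lborel)"
        unfolding J_def by (subst integral_lborel_prod(1)[OF iN2]) (simp add: N2_def)
      also have "\<dots> = (\<integral>x. ((1 - \<theta>1 x) / (x - fst z)) * (- pi * a (x, snd z)) \<partial>lborel)"
        by (simp only: Bochner_Integration.integral_mult_right_zero E2[OF z2])
      also have "\<dots> = (\<integral>x. - pi * (((1 - \<theta>1 x) * a (x, snd z)) / (x - fst z)) \<partial>lborel)"
        by (intro Bochner_Integration.integral_cong) auto
      finally show ?thesis by (simp only: Bochner_Integration.integral_mult_right_zero)
    qed
    have "J N1 z + J N2 z - J d z = (\<integral>p. N1 p / ((fst p - fst z) * (snd p - snd z))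
        + N2 p / ((fst p - fst z) * (snd p - snd z)) - d p / ((fst p - fst z) * (snd p - snd z)) \<partial>lborel)"
      unfolding J_def using iN1 iN2 id by simp
    also have "\<dots> = (\<integral>p. ?I p / ((fst p - fst z) * (snd p - snd z)) + N p / ((fst p - fst z) * (snd p - snd z)) \<partial>lborel)"
    proof -
      \<comment> \<open>The coefficients of \<open>d\<close> add up to
        \<open>- (1 - \<theta>1) * (1 - \<theta>2)\<close>, and \<open>C1.X * b\<close> splits into
        its \<open>\<theta>2\<close> part \<open>?I\<close> and its \<open>1 - \<theta>2\<close>
        part in \<open>N\<close>.\<close>
      have "N1 p + N2 p - d p = ?I p + N p" for p
        by (simp add: N1_def N2_def N_def Q_def algebra_simps)
      then show ?thesis by (simp only: add_divide_distrib[symmetric] diff_divide_distrib[symmetric])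
    qed
    also have "\<dots> = J ?I z + J N z"
      unfolding J_def using iI iN by simp
    finally have J_eq: "J N1 z + J N2 z - J d z = J ?I z + J N z" .
    have pi: "complex_of_real pi \<noteq> 0" by simp
    have "T z = - (1 / pi) * (- (1 / pi) * J N1 z) - (1 / pi) * (A z - (1 / pi) * J N2 z) - (1 / pi\<^sup>2) * J d z"
      unfolding T_def a_split J_def[symmetric] b_eq[symmetric] a_eq[symmetric] by simp
    also have "\<dots> = - (1 / pi) * A z + (1 / pi\<^sup>2) * (J N1 z + J N2 z - J d z)"
      using pi by (simp add: field_simps power2_eq_square)
    finally show ?thesis unfolding J_eq .
  qed

  define T' where "T' h = - (1 / pi) * G2 h + (1 / pi\<^sup>2) * (G1 h + G3 h)" for h
  have "((\<lambda>z. - (1 / pi) * A z + (1 / pi\<^sup>2) * (J ?I z + J N z)) has_derivative T') (at (c1, c2))"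
    unfolding T'_def A_def J_def by (intro has_derivative_add has_derivative_mult_right G1 G2 G3)
  then have T: "(T has_derivative T') (at (c1, c2))"
    by (rule has_derivative_transform_within_open[of _ _ _ _ "ball c1 r1 \<times> ball c2 r2"])
       (use decomp C1.r C2.r in \<open>auto intro: open_Times\<close>)
  have T'_sum: "T' h + \<i> * T' k = - (1 / pi) * (G2 h + \<i> * G2 k)
      + (1 / pi\<^sup>2) * ((G1 h + \<i> * G1 k) + (G3 h + \<i> * G3 k))" for h k
    by (simp add: T'_def algebra_simps add_divide_distrib)
  have cc: "c1 \<in> ball c1 r1" "c2 \<in> ball c2 r2" using C1.r C2.r by auto
  have 1: "T' (1, 0) + \<i> * T' (\<i>, 0) = 2 * a (c1, c2)"
    unfolding T'_sum G1 G2 G3 using C1.one[OF cc(1)] by (simp add: \<psi>_def)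
  \<comment> \<open>\<open>\<theta>1\<close> does not depend on the second variable, so the
    derivative falls on \<open>a\<close> alone and \<open>dbar\<close> turns it into
    \<open>2 * d\<close>.\<close>
  have "G2 (0, 1) + \<i> * G2 (0, \<i>) = (\<integral>\<zeta>. 2 * (\<theta>1 \<zeta> * d (\<zeta>, c2) / (\<zeta> - c1)) \<partial>lborel)"
  proof -
    have "\<theta>1' z 0 = 0" for z using C1.bnd'[of z 0] by simp
    then have "\<psi>' (\<zeta>, c2) (0, 1) + \<i> * \<psi>' (\<zeta>, c2) (0, \<i>) = \<theta>1 \<zeta> * (a' (\<zeta>, c2) (0, 1) + \<i> * a' (\<zeta>, c2) (0, \<i>))" for \<zeta>
      by (simp add: \<psi>'_def algebra_simps)
    then show ?thesis unfolding G2 dbar by (simp add: ac_simps)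
  qed
  then have G2': "G2 (0, 1) + \<i> * G2 (0, \<i>) = 2 * (\<integral>\<zeta>. \<theta>1 \<zeta> * d (\<zeta>, c2) / (\<zeta> - c1) \<partial>lborel)"
    by (simp only: Bochner_Integration.integral_mult_right_zero)
  \<comment> \<open>\<open>E1\<close> at the base point trades the integral of
    \<open>\<theta>1 * d\<close> for \<open>b\<close> and an integral of \<open>C1.X * b\<close>.
    The latter cancels against the contribution of \<open>G1\<close>, because \<open>Q\<close> and
    \<open>b\<close> agree on the line with second coordinate \<open>c2\<close>.\<close>
  have "(\<integral>\<zeta>. \<theta>1 \<zeta> * d (\<zeta>, c2) / (\<zeta> - c1) \<partial>lborel) + (\<integral>\<zeta>. C1.X \<zeta> * b (\<zeta>, c2) / (\<zeta> - c1) \<partial>lborel) = - pi * b (c1, c2)"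
  proof -
    have "integrable lborel (\<lambda>\<zeta>. \<theta>1 \<zeta> * d (\<zeta>, c2) / (\<zeta> - c1))"
    proof (rule i1)
      show "norm (\<theta>1 w * d (w, c2)) \<le> 1 * M" for w by (intro norm_mult_mono bnd C1.bnd)
      show "\<theta>1 w * d (w, c2) = 0" if "norm w > R" for w
        using off(3)[OF outside, of "(w, c2)"] that by simp
    qed measurable
    moreover have "integrable lborel (\<lambda>\<zeta>. C1.X \<zeta> * b (\<zeta>, c2) / (\<zeta> - c1))"
    proof (rule i1)
      show "norm (C1.X w * b (w, c2)) \<le> L1 * M" for w by (intro norm_mult_mono bnd C1.X_bound)
      show "C1.X w * b (w, c2) = 0" if "norm w > R" for w
        using off(2)[OF outside, of "(w, c2)"] that by simp
    qed measurable
    ultimately have "(\<integral>\<zeta>. \<theta>1 \<zeta> * d (\<zeta>, c2) / (\<zeta> - c1) \<partial>lborel) + (\<integral>\<zeta>. C1.X \<zeta> * b (\<zeta>, c2) / (\<zeta> - c1) \<partial>lborel)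
        = (\<integral>\<zeta>. (\<theta>1 \<zeta> * d (\<zeta>, c2) + C1.X \<zeta> * b (\<zeta>, c2)) / (\<zeta> - c1) \<partial>lborel)"
      by (simp add: add_divide_distrib)
    then show ?thesis unfolding E1[OF cc(1)] .
  qed
  then have d_eq: "(\<integral>\<zeta>. \<theta>1 \<zeta> * d (\<zeta>, c2) / (\<zeta> - c1) \<partial>lborel)
      = - pi * b (c1, c2) - (\<integral>\<zeta>. C1.X \<zeta> * b (\<zeta>, c2) / (\<zeta> - c1) \<partial>lborel)"
    by (simp add: eq_diff_eq)
  have Q_eq: "Q (\<zeta>, c2) = b (\<zeta>, c2)" for \<zeta>
    using C2.one[OF cc(2)] by (simp add: Q_def)
  have 2: "T' (0, 1) + \<i> * T' (0, \<i>) = 2 * b (c1, c2)"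
    unfolding T'_sum G1 G3 G2' d_eq Q_eq
    by (simp add: field_simps power2_eq_square)
  from that[OF T 1 2] show ?thesis .
qed

end

section \<open>Passage from forms on the closed product to the zero extension\<close>

theorem proposition0p1:
  fixes D1 D2 :: "complex set" and f1 f2 :: "complex \<times> complex \<Rightarrow> complex"
  assumes "bounded_C1_domain D1" and "bounded_C1_domain D2"
    and "C1_on_closure (D1 \<times> D2) f1" and "C1_on_closure (D1 \<times> D2) f2"
    and "dbar_closed_on (D1 \<times> D2) f1 f2"
  shows "solves_dbar_on (D1 \<times> D2) (T_op D1 D2 f1 f2) f1 f2"
proof -
  let ?\<Omega> = "D1 \<times> D2"
  have D: "open D1" "open D2" "bounded D1" "bounded D2"
    using assms(1,2) by (auto simp: bounded_C1_domain_def)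
  have open_\<Omega>: "open ?\<Omega>" using D by (intro open_Times)
  have comp: "compact (closure ?\<Omega>)" using D by (simp add: compact_closure bounded_Times)
  obtain f1' where f1: "continuous_on (closure ?\<Omega>) f1" "continuous_on (closure ?\<Omega>) f1'"
      "\<And>p. p \<in> ?\<Omega> \<Longrightarrow> (f1 has_derivative blinfun_apply (f1' p)) (at p)"
    using assms(3) by (auto simp: C1_on_closure_def C1_on_def)
  obtain f2' where f2: "continuous_on (closure ?\<Omega>) f2" "continuous_on (closure ?\<Omega>) f2'"
      "\<And>p. p \<in> ?\<Omega> \<Longrightarrow> (f2 has_derivative blinfun_apply (f2' p)) (at p)"
    using assms(4) by (auto simp: C1_on_closure_def C1_on_def)
  \<comment> \<open>Regularity up to the closure enters here: the closure is compact, so the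
    coefficients and their derivatives are uniformly bounded on the open product.\<close>
  have bounded_image: "\<exists>B. \<forall>p\<in>?\<Omega>. norm (g p) \<le> B"
    if "continuous_on (closure ?\<Omega>) g" for g :: "complex \<times> complex \<Rightarrow> 'z::real_normed_vector"
    using compact_imp_bounded[OF compact_continuous_image[OF that comp]] closure_subset[of ?\<Omega>]
    unfolding bounded_iff by blast
  obtain B1 B2 B1' B2' where B:
      "\<And>p. p \<in> ?\<Omega> \<Longrightarrow> norm (f1 p) \<le> B1" "\<And>p. p \<in> ?\<Omega> \<Longrightarrow> norm (f2 p) \<le> B2"
      "\<And>p. p \<in> ?\<Omega> \<Longrightarrow> norm (f1' p) \<le> B1'" "\<And>p. p \<in> ?\<Omega> \<Longrightarrow> norm (f2' p) \<le> B2'"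
    using bounded_image[OF f1(1)] bounded_image[OF f2(1)] bounded_image[OF f1(2)] bounded_image[OF f2(2)]
    by blast
  define M where "M = \<bar>B1\<bar> + \<bar>B2\<bar> + \<bar>B1'\<bar> + \<bar>B2'\<bar>"
  have M0: "M \<ge> 0" by (simp add: M_def)
  have BM: "norm (f1 p) \<le> M" "norm (f2 p) \<le> M" "norm (f1' p) \<le> M" "norm (f2' p) \<le> M" if "p \<in> ?\<Omega>" for p
    using B[OF that] by (auto simp: M_def)
  have f'_bound: "norm (f1' p h) \<le> M * norm h" "norm (f2' p h) \<le> M * norm h" if "p \<in> ?\<Omega>" for p h
    using BM(3,4)[OF that]
    by (auto intro: order_trans[OF norm_blinfun mult_right_mono])
  obtain R1 R2 where R: "\<And>z. z \<in> D1 \<Longrightarrow> norm z \<le> R1" "\<And>z. z \<in> D2 \<Longrightarrow> norm z \<le> R2"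
    using D(3,4) by (auto simp: bounded_iff)
  define a where "a p = indicator ?\<Omega> p *\<^sub>R f1 p" for p
  define b where "b p = indicator ?\<Omega> p *\<^sub>R f2 p" for p
  define a' where "a' p h = indicator ?\<Omega> p *\<^sub>R f1' p h" for p h
  define b' where "b' p h = indicator ?\<Omega> p *\<^sub>R f2' p h" for p h
  \<comment> \<open>Writing the mixed derivative through \<open>f1'\<close> exhibits it as
    continuous on the product, whence its zero extension is Borel.\<close>
  define d where "d p = indicator ?\<Omega> p *\<^sub>R ((f1' p (0, 1) + \<i> * f1' p (0, \<i>)) / 2)" for p
  have dbar2_f1: "dbar2 f1 p = (f1' p (0, 1) + \<i> * f1' p (0, \<i>)) / 2" if "p \<in> ?\<Omega>" for p
    using dbar_has_derivative(2)[OF f1(3)[OF that]] .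
  \<comment> \<open>Closedness lets the single function \<open>d\<close> serve as the
    antiholomorphic derivative of both coefficients.\<close>
  have closed: "(f2' p (1, 0) + \<i> * f2' p (\<i>, 0)) = (f1' p (0, 1) + \<i> * f1' p (0, \<i>))" if "p \<in> ?\<Omega>" for p
  proof -
    have "dbar2 f1 p = dbar1 f2 p" using assms(5) that unfolding dbar_closed_on_def by blast
    then have "(f2' p (1, 0) + \<i> * f2' p (\<i>, 0)) / 2 = (f1' p (0, 1) + \<i> * f1' p (0, \<i>)) / 2"
      unfolding dbar_has_derivative(1)[OF f2(3)[OF that], symmetric] dbar2_f1[OF that, symmetric] by simp
    moreover have "x = y" if "x / 2 = y / 2" for x y :: complex using that by simp
    ultimately show ?thesis by blast
  qed
  interpret closed_form D1 D2 a b d a' b' M "max R1 R2"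
  proof
    show "open D1" "open D2" by (rule D)+
    show "norm z \<le> max R1 R2" if "z \<in> D1" for z using R(1)[OF that] by simp
    show "norm z \<le> max R1 R2" if "z \<in> D2" for z using R(2)[OF that] by simp
    have \<Omega>_sets: "?\<Omega> \<in> sets borel" using open_\<Omega> by simp
    have sub: "continuous_on ?\<Omega> g" if "continuous_on (closure ?\<Omega>) g" for g :: "complex \<times> complex \<Rightarrow> 'z::topological_space"
      using that closure_subset by (rule continuous_on_subset)
    show "a \<in> borel_measurable borel" "b \<in> borel_measurable borel"
      unfolding a_def b_def
      by (intro borel_measurable_continuous_on_indicator \<Omega>_sets sub f1 f2)+
    show "d \<in> borel_measurable borel"
      unfolding d_def
      by (intro borel_measurable_continuous_on_indicator \<Omega>_sets continuous_intros sub[OF f1(2)]) auto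
    show "a p = 0" "b p = 0" "d p = 0" "a' p h = 0" "b' p h = 0" if "p \<notin> ?\<Omega>" for p h
      using that by (simp_all add: a_def b_def d_def a'_def b'_def)
    show "norm (a p) \<le> M" "norm (b p) \<le> M" for p
      using BM[of p] M0 by (auto simp: a_def b_def indicator_def)
    show "norm (a' p h) \<le> M * norm h" "norm (b' p h) \<le> M * norm h" for p h
      using f'_bound[of p h] M0 by (auto simp: a'_def b'_def indicator_def)
    show "norm (d p) \<le> M" for p
    proof (cases "p \<in> ?\<Omega>")
      case True
      have "norm (f1' p (0, 1) + \<i> * f1' p (0, \<i>)) \<le> M + M"
        using f'_bound(1)[OF True, of "(0, 1)"] f'_bound(1)[OF True, of "(0, \<i>)"]
        by (intro order_trans[OF norm_triangle_ineq] add_mono) (auto simp: norm_mult norm_Pair)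
      then show ?thesis using True by (simp add: d_def norm_divide)
    qed (simp add: d_def M0)
    show "(a has_derivative a' p) (at p)" "(b has_derivative b' p) (at p)" if "p \<in> ?\<Omega>" for p
    proof -
      have "a' p = blinfun_apply (f1' p)" "b' p = blinfun_apply (f2' p)"
        using that by (auto simp: a'_def b'_def)
      then show "(a has_derivative a' p) (at p)" "(b has_derivative b' p) (at p)"
        using has_derivative_transform_within_open[OF f1(3)[OF that] open_\<Omega> that, of a]
          has_derivative_transform_within_open[OF f2(3)[OF that] open_\<Omega> that, of b]
        by (simp_all add: a_def b_def)
    qed
    show "a' p (0, 1) + \<i> * a' p (0, \<i>) = 2 * d p" for p
      by (simp add: a'_def d_def indicator_def)
    show "b' p (1, 0) + \<i> * b' p (\<i>, 0) = 2 * d p" for p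
      using closed[of p] by (simp add: b'_def d_def indicator_def)
  qed
  \<comment> \<open>The operators are compared only on the product, since for \<open>z1\<close>
    outside \<open>D1\<close> the slice of \<open>b\<close> is zero whereas that of
    \<open>f2\<close> is arbitrary. The product is open, which suffices to transfer
    derivatives.\<close>
  have T_eq: "T_op D1 D2 f1 f2 z = T z" if "z \<in> ?\<Omega>" for z
  proof -
    obtain z1 z2 where z: "z = (z1, z2)" "z1 \<in> D1" "z2 \<in> D2" using \<open>z \<in> ?\<Omega>\<close> by auto
    have 1: "form_integral1 D2 (\<lambda>\<zeta>2. f2 (z1, \<zeta>2) / (\<zeta>2 - z2)) = 2 * \<i> * (\<integral>\<zeta>. b (z1, \<zeta>) / (\<zeta> - z2) \<partial>lborel)"
      unfolding form_integral1_def set_lebesgue_integral_def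
      using z by (intro arg_cong[where f = "\<lambda>x. 2 * \<i> * x"] Bochner_Integration.integral_cong) (auto simp: b_def indicator_def)
    have 2: "form_integral1 D1 (\<lambda>\<zeta>1. f1 (\<zeta>1, z2) / (\<zeta>1 - z1)) = 2 * \<i> * (\<integral>\<zeta>. a (\<zeta>, z2) / (\<zeta> - z1) \<partial>lborel)"
      unfolding form_integral1_def set_lebesgue_integral_def
      using z by (intro arg_cong[where f = "\<lambda>x. 2 * \<i> * x"] Bochner_Integration.integral_cong) (auto simp: a_def indicator_def)
    have 3: "form_integral2 ?\<Omega> (\<lambda>(\<zeta>1, \<zeta>2). dbar2 f1 (\<zeta>1, \<zeta>2) / ((\<zeta>1 - z1) * (\<zeta>2 - z2)))
        = (2 * \<i>)\<^sup>2 * (\<integral>p. d p / ((fst p - z1) * (snd p - z2)) \<partial>lborel)"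
      unfolding form_integral2_def set_lebesgue_integral_def
      by (intro arg_cong[where f = "\<lambda>x. (2 * \<i>)\<^sup>2 * x"] Bochner_Integration.integral_cong)
         (auto simp: d_def dbar2_f1 indicator_def)
    show ?thesis
      unfolding z(1) T_op_def T_def case_prod_conv 1 2 3
      by (simp add: field_simps power2_eq_square)
  qed
  show ?thesis
    unfolding solves_dbar_on_def
  proof
    fix z assume z: "z \<in> ?\<Omega>"
    then obtain z1 z2 where zz: "z = (z1, z2)" "z1 \<in> D1" "z2 \<in> D2" by auto
    obtain T' where T': "(T has_derivative T') (at z)"
        "T' (1, 0) + \<i> * T' (\<i>, 0) = 2 * a z" "T' (0, 1) + \<i> * T' (0, \<i>) = 2 * b z"
      using T_has_derivative[OF zz(2,3)] unfolding zz(1) by blast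
    have u: "(T_op D1 D2 f1 f2 has_derivative T') (at z)"
      by (rule has_derivative_transform_within_open[OF T'(1) open_\<Omega> z]) (simp add: T_eq)
    show "T_op D1 D2 f1 f2 differentiable at z
        \<and> dbar1 (T_op D1 D2 f1 f2) z = f1 z \<and> dbar2 (T_op D1 D2 f1 f2) z = f2 z"
      using dbar_has_derivative[OF u] differentiableI[OF u] T'(2,3) z by (simp add: a_def b_def)
  qed
qed

end
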